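(* Let $d\ge 1$ and $E\in(-2d,2d)$. Let $\nu$ be a probability measure on $\mathbb{R}$ with $\int|x|\,d\nu(x)<\infty$ and let $\{q^\omega(n)\}_{n\in\mathbb{Z}^d}$ be independent real random variables each distributed according to $\nu$. For each coupling constant $\eta>0$ put $V^\omega(n)=\eta\,q^\omega(n)$, $n\in\mathbb{Z}^d$, and $H^\omega=\Delta+V^\omega$ on $\ell^2(\mathbb{Z}^d)$. Let $\epsilon(\eta)>0$ be a function of $\eta>0$ such that $\epsilon(\eta)\to\infty$ as $\eta\to0$ and $\lim_{\eta\to0}\epsilon(\eta)^2\eta=0$. Then for almost every $\omega$ the families of measures $\{\mu_{\epsilon(\eta),E}^\omega\}$ (formed with the operator $H^\omega$ with coupling constant $\eta$) and $\{\mu_{\epsilon(\eta),E}^0\}$ have the same limit points in the sense of distributions on $\mathbb{R}$ as $\eta\to0$.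
   Context: On $\ell^2(\mathbb{Z}^d)$ the operator $\Delta$ is $(\Delta u)(n)=\sum_{|m-n|=1}u(m)$ (sum over the $2d$ nearest neighbours of $n$; no diagonal term), with spectrum $[-2d,2d]$, and $V^\omega$ acts as multiplication, $(V^\omega u)(m)=V^\omega(m)u(m)$. The random variables $q^\omega(n)$ do not depend on $\eta$. For $L>0$ let $\Lambda_L=\{n=(n_1,\dots,n_d)\in\mathbb{Z}^d: |n_i|\le L,\ i=1,\dots,d\}$ and let $\chi_{\Lambda_L}$ be the orthogonal projection onto $\ell^2(\Lambda_L)$. Define the finite matrices, acting on $\ell^2(\Lambda_L)$, $$\Delta_{L,E}=(L+1)\chi_{\Lambda_L}(\Delta-E)\chi_{\Lambda_L},\qquad H^\omega_{L,E}=(L+1)\chi_{\Lambda_L}(H^\omega-E)\chi_{\Lambda_L}.$$ For a self-adjoint operator $A$, $E_A(\cdot)$ denotes its projection-valued spectral measure. The positive measures on $\mathbb{R}$ in question are $$\mu_{L,E}^0(\cdot)=\frac{1}{(2L+1)^{d-1}}\mathrm{Tr}\big(E_{\Delta_{L,E}}(\cdot)\big),\qquad \mu_{L,E}^\omega(\cdot)=\frac{1}{(2L+1)^{d-1}}\mathrm{Tr}\big(E_{H^\omega_{L,E}}(\cdot)\big),$$ taken with $L=\epsilon(\eta)$. A limit point in the sense of distributions, as $\eta\to0$, of a family of measures $\{\mu_\eta\}_{\eta>0}$ is a distribution $\Psi$ on $\mathbb{R}$ such that along some sequence $\eta_k\to0$, $\eta_k>0$, one has $\int f\,d\mu_{\eta_k}\to\Psi(f)$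 for every $f\in C_0^\infty(\mathbb{R})$. *)

theory Defs
  imports "HOL-Probability.Probability"
begin

type_synonym 'd site = "int ^ 'd"
type_synonym 'd wave = "int ^ 'd \<Rightarrow> complex"

definition ell2_on :: "('d::finite) site set \<Rightarrow> 'd wave set" where
  "ell2_on S = {u. (\<forall>n. n \<notin> S \<longrightarrow> u n = 0) \<and> (\<lambda>n. (cmod (u n))\<^sup>2) summable_on UNIV}"

definition ell2_inner :: "('d::finite) wave \<Rightarrow> 'd wave \<Rightarrow> complex" where
  "ell2_inner u v = (\<Sum>\<^sub>\<infinity>n. cnj (u n) * v n)"

definition orth_proj :: "('d::finite) wave set \<Rightarrow> 'd wave \<Rightarrow> 'd wave" where
  "orth_proj W u = (THE v. v \<in> W \<and> (\<forall>w\<in>W. ell2_inner w (\<lambda>n. u n - v n) = 0))"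

text \<open>Operators are maps on all complex functions on the lattice. Since \<open>V\<close> may be
  unbounded, the Hamiltonian is given by its formal action; the compressions below only
  apply it to finitely supported functions, which lie in its domain.\<close>

definition lattice_laplacian :: "('d::finite) wave \<Rightarrow> 'd wave" where
  "lattice_laplacian u = (\<lambda>n. \<Sum>m\<in>{m. (\<Sum>i\<in>UNIV. \<bar>m $ i - n $ i\<bar>) = 1}. u m)"

definition hamiltonian :: "(('d::finite) site \<Rightarrow> real) \<Rightarrow> 'd wave \<Rightarrow> 'd wave" where
  "hamiltonian V u = (\<lambda>n. lattice_laplacian u n + of_real (V n) * u n)"

definition box :: "real \<Rightarrow> ('d::finite) site set" where
  "box L = {n. \<forall>i. real_of_int \<bar>n $ i\<bar> \<le> L}"

definition restrict_to :: "('d::finite) site set \<Rightarrow> 'd wave \<Rightarrow> 'd wave" where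
  "restrict_to S u = (\<lambda>n. if n \<in> S then u n else 0)"

lemma restrict_to_eq_orth_proj:
  fixes u :: "('d::finite) wave"
  assumes u: "u \<in> ell2_on UNIV"
  shows "orth_proj (ell2_on S) u = restrict_to S u"
  unfolding orth_proj_def
proof (rule the_equality, intro conjI ballI)
  show "restrict_to S u \<in> ell2_on S"
    using u unfolding ell2_on_def restrict_to_def
    by (auto intro: summable_on_comparison_test[where f = "\<lambda>n. (cmod (u n))\<^sup>2"])
  fix w :: "'d wave" assume w: "w \<in> ell2_on S"
  have "(\<lambda>n. cnj (w n) * (u n - restrict_to S u n)) = (\<lambda>n. 0)"
    using w by (auto simp: ell2_on_def restrict_to_def)
  then show "ell2_inner w (\<lambda>n. u n - restrict_to S u n) = 0"
    by (simp add: ell2_inner_def)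
next
  fix v assume v: "v \<in> ell2_on S \<and> (\<forall>w\<in>ell2_on S. ell2_inner w (\<lambda>n. u n - v n) = 0)"
  show "v = restrict_to S u"
  proof
    fix n
    show "v n = restrict_to S u n"
    proof (cases "n \<in> S")
      case True
      define w :: "'d wave" where "w = (\<lambda>m. if m = n then 1 else 0)"
      have "(\<lambda>m. (cmod (w m))\<^sup>2) summable_on UNIV"
        by (rule summable_on_cong_neutral[where T = "{n}" and S = UNIV, THEN iffD2, rotated -1])
          (auto simp: w_def)
      then have "w \<in> ell2_on S" using True by (auto simp: ell2_on_def w_def)
      then have "(\<Sum>\<^sub>\<infinity>m. cnj (w m) * (u m - v m)) = 0"
        using v by (simp add: ell2_inner_def)
      moreover have "(\<Sum>\<^sub>\<infinity>m. cnj (w m) * (u m - v m)) = (\<Sum>\<^sub>\<infinity>m\<in>{n}. cnj (w m) * (u m - v m))"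
        by (rule infsum_cong_neutral) (auto simp: w_def)
      ultimately show ?thesis using True by (simp add: w_def restrict_to_def)
    next
      case False
      then show ?thesis using v by (simp add: ell2_on_def restrict_to_def)
    qed
  qed
qed

definition scaled_compression ::
    "real \<Rightarrow> real \<Rightarrow> (('d::finite) wave \<Rightarrow> 'd wave) \<Rightarrow> 'd wave \<Rightarrow> 'd wave" where
  "scaled_compression L E A u = (\<lambda>n. of_real (L + 1) *
     restrict_to (box L)
       (\<lambda>m. A (restrict_to (box L) u) m - of_real E * restrict_to (box L) u m) n)"

definition eigenspace_on ::
    "('d::finite) site set \<Rightarrow> ('d wave \<Rightarrow> 'd wave) \<Rightarrow> real \<Rightarrow> 'd wave set" where
  "eigenspace_on S A x = {u \<in> ell2_on S. A u = (\<lambda>n. of_real x * u n)}"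

text \<open>For finite \<open>S\<close> and \<open>A\<close> self-adjoint on \<open>ell2_on S\<close>, the spectral measure of \<open>A\<close>
  assigns to \<open>B\<close> the sum of the eigenprojections over the (finitely many, real)
  eigenvalues in \<open>B\<close>.\<close>

definition spectral_proj ::
    "('d::finite) site set \<Rightarrow> ('d wave \<Rightarrow> 'd wave) \<Rightarrow> real set \<Rightarrow> 'd wave \<Rightarrow> 'd wave" where
  "spectral_proj S A B u =
     (\<lambda>n. \<Sum>x\<in>{x \<in> B. eigenspace_on S A x \<noteq> {\<lambda>_. 0}}. orth_proj (eigenspace_on S A x) u n)"

definition delta :: "('d::finite) site \<Rightarrow> 'd wave" where
  "delta n = (\<lambda>m. if m = n then 1 else 0)"

definition trace_on :: "('d::finite) site set \<Rightarrow> ('d wave \<Rightarrow> 'd wave) \<Rightarrow> complex" where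
  "trace_on S T = (\<Sum>n\<in>S. ell2_inner (delta n) (T (delta n)))"

definition spectral_counting_measure ::
    "real \<Rightarrow> real \<Rightarrow> (('d::finite) wave \<Rightarrow> 'd wave) \<Rightarrow> real measure" where
  "spectral_counting_measure L E A = measure_of UNIV (sets borel)
     (\<lambda>B. ennreal (1 / (2 * L + 1) ^ (CARD('d) - 1) *
        Re (trace_on (box L) (spectral_proj (box L) (scaled_compression L E A) B))))"

text \<open>Test functions and distributions on the real line are complex-valued.\<close>

definition nth_deriv :: "nat \<Rightarrow> (real \<Rightarrow> complex) \<Rightarrow> real \<Rightarrow> complex" where
  "nth_deriv k f = ((\<lambda>g x. vector_derivative g (at x)) ^^ k) f"

definition test_functions :: "(real \<Rightarrow> complex) set" where
  "test_functions = {f. (\<forall>k x. nth_deriv k f differentiable (at x)) \<and>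
     compact (closure {x. f x \<noteq> 0})}"

text \<open>A distribution is a linear functional on test functions satisfying the usual seminorm
  estimates on every compact set. Its values off \<open>test_functions\<close> are irrelevant.\<close>

definition is_distribution :: "((real \<Rightarrow> complex) \<Rightarrow> complex) \<Rightarrow> bool" where
  "is_distribution \<Psi> \<longleftrightarrow>
     (\<forall>f\<in>test_functions. \<forall>g\<in>test_functions. \<Psi> (\<lambda>x. f x + g x) = \<Psi> f + \<Psi> g) \<and>
     (\<forall>f\<in>test_functions. \<forall>c. \<Psi> (\<lambda>x. c * f x) = c * \<Psi> f) \<and>
     (\<forall>K. compact K \<longrightarrow> (\<exists>C N. \<forall>f\<in>test_functions. closure {x. f x \<noteq> 0} \<subseteq> K \<longrightarrow>
        cmod (\<Psi> f) \<le> C * (\<Sum>k\<le>N. SUP x. cmod (nth_deriv k f x))))"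

definition distributional_limit_points ::
    "(real \<Rightarrow> real measure) \<Rightarrow> ((real \<Rightarrow> complex) \<Rightarrow> complex) set" where
  "distributional_limit_points \<mu> = {\<Psi>. is_distribution \<Psi> \<and>
     (\<exists>\<eta>. (\<forall>k::nat. \<eta> k > 0) \<and> \<eta> \<longlonglongrightarrow> 0 \<and>
        (\<forall>f\<in>test_functions. (\<lambda>k. \<integral>x. f x \<partial>\<mu> (\<eta> k)) \<longlonglongrightarrow> \<Psi> f))}"

end

theory Submission
  imports Defs
begin

text \<open>
The random and the free counting measures become indistinguishable: almost surely
\<open>\<integral> f d\<mu>\<^sup>\<omega> - \<integral> f d\<mu>\<^sup>0\<close> tends to zero for every test function \<open>f\<close> (\<open>distributional_limit_points_subset\<close>
turns this into an inclusion between the sets of limit points). Two estimates give this.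

The first is deterministic. The two compressed matrices differ by a diagonal matrix with entries
\<open>D n = (L + 1) * V n\<close>, and for Hermitian matrices \<open>A\<close> and \<open>B\<close> the difference of the traces of \<open>f A\<close> and
\<open>f B\<close> is at most a constant, depending only on \<open>f\<close>, times \<open>\<Sum>n. \<bar>D n\<bar>\<close>
(\<open>trace_test_function_diff_le\<close>). It matters that this bound is the trace norm of \<open>A - B\<close>, without a factor
growing with the size of the matrices. For convex \<open>h\<close> with \<open>\<bar>h'\<bar> \<le> C\<close> it is Klein's inequality
\<open>Tr (h A) - Tr (h B) \<ge> Tr (h' B * (A - B)) \<ge> - C * Tr \<bar>A - B\<bar>\<close>, used in both directions: expand one
orthonormal eigenbasis in the other and apply the tangent-line inequality to each pair of eigenvalues. The real
and imaginary parts of a test function are differences of two such convex functions, because a multiple of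
\<open>x * arctan x - ln (1 + x\<^sup>2) / 2\<close> has a bounded derivative and a second derivative that dominates
\<open>\<bar>f''\<bar>\<close>. The eigenbases come from maximising the Rayleigh quotient on orthogonal complements
(\<open>eigenbasis_exists\<close>), and in terms of them the counting measure is a multiple of the sum of the point masses at
the eigenvalues (\<open>integral_spectral_counting_measure\<close>).

The second estimate is probabilistic: almost surely there is a \<open>Q\<close> such that the sum of \<open>\<bar>q n\<bar>\<close> over every box of
radius \<open>L > 0\<close> is at most \<open>Q * (2 * L + 1) ^ d\<close> (\<open>AE_box_sums_bounded\<close>). This is the part of the strong law of
large numbers that is needed. It follows from Etemadi's truncation argument along the dyadic boxes, where the
finite first moment makes the Borel-Cantelli series converge.

With \<open>V = \<eta> * q\<close> the two integrals thus differ by at most a constant times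
\<open>(L + 1) * \<eta> * (2 * L + 1) ^ d / (2 * L + 1) ^ (d - 1)\<close>, which is of order \<open>L\<^sup>2 * \<eta>\<close> and tends to zero for
\<open>L = \<epsilon> \<eta>\<close>. The exceptional null set is the one where \<open>Q\<close> does not exist, and it depends neither on \<open>f\<close> nor on
the sequence of coupling constants.
\<close>

section \<open>Functions supported on a finite set and Hermitian kernels\<close>

definition supported :: "'i set \<Rightarrow> ('i \<Rightarrow> complex) set" where
  "supported S = {u. \<forall>n. n \<notin> S \<longrightarrow> u n = 0}"

definition dot :: "'i set \<Rightarrow> ('i \<Rightarrow> complex) \<Rightarrow> ('i \<Rightarrow> complex) \<Rightarrow> complex" where
  "dot S u v = (\<Sum>n\<in>S. cnj (u n) * v n)"

definition kernel_op :: "'i set \<Rightarrow> ('i \<Rightarrow> 'i \<Rightarrow> complex) \<Rightarrow> ('i \<Rightarrow> complex) \<Rightarrow> 'i \<Rightarrow> complex" where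
  "kernel_op S K u = (\<lambda>n. if n \<in> S then \<Sum>m\<in>S. K n m * u m else 0)"

definition hermitian_kernel :: "('i \<Rightarrow> 'i \<Rightarrow> complex) \<Rightarrow> bool" where
  "hermitian_kernel K \<longleftrightarrow> (\<forall>n m. K n m = cnj (K m n))"

definition orthonormal_eigenvectors ::
    "'i set \<Rightarrow> ('i \<Rightarrow> 'i \<Rightarrow> complex) \<Rightarrow> nat \<Rightarrow> (nat \<Rightarrow> 'i \<Rightarrow> complex) \<Rightarrow> (nat \<Rightarrow> real) \<Rightarrow> bool" where
  "orthonormal_eigenvectors S K N e a \<longleftrightarrow>
     (\<forall>i<N. e i \<in> supported S \<and> kernel_op S K (e i) = (\<lambda>n. of_real (a i) * e i n)) \<and>
     (\<forall>i<N. \<forall>j<N. dot S (e i) (e j) = (if i = j then 1 else 0))"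

text \<open>The eigenvalues \<open>a\<close> are listed with multiplicity, so that a trace of a function of the operator becomes a sum over
\<open>i < N\<close>. The expansion property stands in for a dimension count.\<close>

definition eigenbasis ::
    "'i set \<Rightarrow> ('i \<Rightarrow> 'i \<Rightarrow> complex) \<Rightarrow> nat \<Rightarrow> (nat \<Rightarrow> 'i \<Rightarrow> complex) \<Rightarrow> (nat \<Rightarrow> real) \<Rightarrow> bool" where
  "eigenbasis S K N e a \<longleftrightarrow> orthonormal_eigenvectors S K N e a \<and>
     (\<forall>u\<in>supported S. u = (\<lambda>n. \<Sum>i<N. dot S (e i) u * e i n))"

lemma dot_cnj: "cnj (dot S u v) = dot S v u"
  by (simp add: dot_def mult.commute)

lemma dot_add_right: "dot S u (\<lambda>n. v n + w n) = dot S u v + dot S u w"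
  by (simp add: dot_def sum.distrib distrib_left)

lemma dot_diff_right: "dot S u (\<lambda>n. v n - w n) = dot S u v - dot S u w"
  by (simp add: dot_def sum_subtractf right_diff_distrib)

lemma dot_scale_right: "dot S u (\<lambda>n. c * v n) = c * dot S u v"
  by (simp add: dot_def sum_distrib_left mult_ac)

lemma dot_sum_right: "dot S u (\<lambda>n. \<Sum>i\<in>I. v i n) = (\<Sum>i\<in>I. dot S u (v i))"
  unfolding dot_def by (subst sum.swap) (simp add: sum_distrib_left)

lemma dot_add_left: "dot S (\<lambda>n. v n + w n) u = dot S v u + dot S w u"
  by (simp add: dot_def sum.distrib distrib_right)

lemma dot_diff_left: "dot S (\<lambda>n. v n - w n) u = dot S v u - dot S w u"
  by (simp add: dot_def sum_subtractf left_diff_distrib)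

lemma dot_scale_left: "dot S (\<lambda>n. c * v n) u = cnj c * dot S v u"
  by (simp add: dot_def sum_distrib_left mult_ac)

lemma dot_sum_left: "dot S (\<lambda>n. \<Sum>i\<in>I. v i n) u = (\<Sum>i\<in>I. dot S (v i) u)"
  unfolding dot_def by (subst sum.swap) (simp add: sum_distrib_right)

lemmas dot_linear = dot_add_left dot_add_right dot_diff_left dot_diff_right dot_scale_left
  dot_scale_right dot_sum_left dot_sum_right

lemma dot_self: "dot S u u = of_real (\<Sum>n\<in>S. (cmod (u n))\<^sup>2)"
  unfolding dot_def of_real_sum complex_norm_square by (simp add: mult.commute)

lemma dot_self_eq_0_iff:
  assumes "finite S" "u \<in> supported S"
  shows "dot S u u = 0 \<longleftrightarrow> u = (\<lambda>_. 0)"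
proof -
  have "dot S u u = 0 \<longleftrightarrow> (\<forall>n\<in>S. u n = 0)"
    using assms(1) by (simp add: dot_self sum_nonneg_eq_0_iff del: of_real_sum)
  also have "\<dots> \<longleftrightarrow> u = (\<lambda>_. 0)" using assms(2) by (auto simp: supported_def fun_eq_iff)
  finally show ?thesis .
qed

lemma dot_delta_left:
  "finite S \<Longrightarrow> n \<in> S \<Longrightarrow> dot S (\<lambda>m. if m = n then 1 else 0) u = u n"
  by (simp add: dot_def if_distrib if_distribR sum.delta cong: if_cong)

lemma kernel_op_supported [simp]: "kernel_op S K u \<in> supported S"
  by (simp add: kernel_op_def supported_def)

lemma kernel_op_add: "kernel_op S K (\<lambda>n. u n + v n) = (\<lambda>n. kernel_op S K u n + kernel_op S K v n)"
  by (auto simp: kernel_op_def fun_eq_iff sum.distrib distrib_left)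

lemma kernel_op_scale: "kernel_op S K (\<lambda>n. c * u n) = (\<lambda>n. c * kernel_op S K u n)"
  by (auto simp: kernel_op_def fun_eq_iff sum_distrib_left mult_ac)

lemma kernel_op_self_adjoint:
  assumes "hermitian_kernel K"
  shows "dot S (kernel_op S K u) v = dot S u (kernel_op S K v)"
proof -
  have cnj: "cnj (K n m) = K m n" for n m
    using assms unfolding hermitian_kernel_def by metis
  have "dot S (kernel_op S K u) v = (\<Sum>n\<in>S. \<Sum>m\<in>S. cnj (K n m) * cnj (u m) * v n)"
    by (simp add: dot_def kernel_op_def sum_distrib_right)
  also have "\<dots> = (\<Sum>m\<in>S. \<Sum>n\<in>S. cnj (u m) * (K m n * v n))"
    by (subst sum.swap) (simp add: cnj mult_ac)
  also have "\<dots> = dot S u (kernel_op S K v)"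
    by (simp add: dot_def kernel_op_def sum_distrib_left)
  finally show ?thesis .
qed


section \<open>The spectral theorem for Hermitian kernels\<close>

lemma supported_combine:
  "u \<in> supported S \<Longrightarrow> v \<in> supported S \<Longrightarrow> (\<lambda>n. u n + c * v n) \<in> supported S"
  by (simp add: supported_def)

lemma continuous_on_coordinate: "continuous_on A (\<lambda>u. u n)"
  for A :: "('i \<Rightarrow> complex) set"
  by (rule continuous_on_subset[OF continuous_on_product_coordinates]) simp

lemma continuous_on_dot:
  assumes "\<And>n. n \<in> S \<Longrightarrow> continuous_on A (\<lambda>u. f u n)" "\<And>n. n \<in> S \<Longrightarrow> continuous_on A (\<lambda>u. g u n)"
  shows "continuous_on A (\<lambda>u. dot S (f u) (g u))"
  unfolding dot_def using assms by (intro continuous_intros) auto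

lemma continuous_on_kernel_op:
  "continuous_on A (\<lambda>u. kernel_op S K u n)"
proof (cases "n \<in> S")
  case True
  have "continuous_on A (\<lambda>u :: 'a \<Rightarrow> complex. \<Sum>m\<in>S. K n m * u m)"
    by (intro continuous_on_sum continuous_on_mult continuous_on_const continuous_on_coordinate)
  then show ?thesis using True by (simp add: kernel_op_def)
qed (simp add: kernel_op_def)

text \<open>All functions on the index set carry the product topology. The sphere lies in a product of discs that are trivial
outside \<open>S\<close>, so Tychonoff's theorem replaces the identification with a Euclidean space.\<close>

lemma compact_unit_sphere_in_subspace:
  fixes V :: "('i \<Rightarrow> complex) set"
  assumes "finite S" "V \<subseteq> supported S" "closed V"
  shows "compact {u \<in> V. dot S u u = 1}"
proof -
  define Q where "Q = (\<lambda>n. if n \<in> S then cball (0::complex) 1 else {0})"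
  have "compactin (product_topology (\<lambda>_. euclidean) UNIV) (PiE UNIV Q)"
    by (subst compactin_PiE) (auto simp: Q_def)
  then have cQ: "compact (PiE UNIV Q)"
    by (simp add: euclidean_product_topology)
  have "closed {u. dot S u u = (1::complex)}"
    by (intro closed_Collect_eq continuous_on_dot continuous_on_coordinate continuous_on_const)
  then have cl: "closed (V \<inter> {u. dot S u u = 1})" using assms by (intro closed_Int)
  have "u n \<in> Q n" if "u \<in> V" "dot S u u = 1" for u n
  proof (cases "n \<in> S")
    case True
    have "of_real (\<Sum>n\<in>S. (cmod (u n))\<^sup>2) = (1 :: complex)" using that by (simp add: dot_self)
    then have "(\<Sum>n\<in>S. (cmod (u n))\<^sup>2) = 1" using of_real_eq_1_iff by blast
    moreover have "(cmod (u n))\<^sup>2 \<le> (\<Sum>n\<in>S. (cmod (u n))\<^sup>2)"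
      using True assms by (intro member_le_sum) auto
    ultimately show ?thesis using True by (simp add: Q_def power_le_one_iff)
  next
    case False
    then show ?thesis using that assms by (auto simp: Q_def supported_def)
  qed
  then have "V \<inter> {u. dot S u u = 1} = PiE UNIV Q \<inter> (V \<inter> {u. dot S u u = 1})" by auto
  with compact_Int_closed[OF cQ cl] show ?thesis by (simp add: Collect_conj_eq)
qed

lemma normalize_in_subspace:
  assumes "finite S" "u \<in> supported S" "u \<noteq> (\<lambda>_. 0)"
  obtains s :: real where "s > 0" "dot S u u = of_real (s\<^sup>2)"
    "dot S (\<lambda>n. of_real (1 / s) * u n) (\<lambda>n. of_real (1 / s) * u n) = 1"
proof -
  define r where "r = (\<Sum>n\<in>S. (cmod (u n))\<^sup>2)"
  have "dot S u u = of_real r" by (simp add: r_def dot_self)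
  moreover have "r \<noteq> 0" using dot_self_eq_0_iff[OF assms(1,2)] assms(3) calculation by auto
  moreover have "r \<ge> 0" by (simp add: r_def sum_nonneg)
  ultimately show ?thesis
    by (intro that[of "sqrt r"]) (auto simp: dot_linear simp flip: of_real_mult of_real_divide)
qed

text \<open>A maximiser \<open>u\<close> of the Rayleigh quotient on the unit sphere of \<open>V\<close> is an eigenvector: moving from \<open>u\<close> in the
direction of the residual \<open>r = T u - a u\<close> would increase the quotient to first order unless \<open>r = 0\<close>.\<close>

lemma eigenvector_in_invariant_subspace:
  fixes V :: "('i \<Rightarrow> complex) set"
  assumes fin: "finite S" and K: "hermitian_kernel K"
    and V: "V \<subseteq> supported S" "closed V"
    and lin: "\<And>u v c. u \<in> V \<Longrightarrow> v \<in> V \<Longrightarrow> (\<lambda>n. u n + c * v n) \<in> V"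
    and inv: "\<And>u. u \<in> V \<Longrightarrow> kernel_op S K u \<in> V"
    and nontrivial: "u0 \<in> V" "u0 \<noteq> (\<lambda>_. 0)"
  obtains u a where "u \<in> V" "dot S u u = 1" "kernel_op S K u = (\<lambda>n. of_real a * u n)"
proof -
  let ?T = "kernel_op S K"
  define sph where "sph = {u \<in> V. dot S u u = 1}"
  have zero: "(\<lambda>_. 0) \<in> V" using lin[OF nontrivial(1,1), of "-1"] by simp
  have scale: "(\<lambda>n. c * u n) \<in> V" if "u \<in> V" for u c using lin[OF zero that] by simp
  obtain s where s: "s > 0" "dot S (\<lambda>n. of_real (1 / s) * u0 n) (\<lambda>n. of_real (1 / s) * u0 n) = 1"
    using normalize_in_subspace[OF fin _ nontrivial(2)] nontrivial(1) V(1) by blast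
  then have "(\<lambda>n. of_real (1 / s) * u0 n) \<in> sph"
    unfolding sph_def using scale[OF nontrivial(1)] by blast
  then have "sph \<noteq> {}" by blast
  moreover have "compact sph"
    unfolding sph_def by (rule compact_unit_sphere_in_subspace[OF fin V])
  moreover have "continuous_on sph (\<lambda>u. Re (dot S u (?T u)))"
    by (rule continuous_on_Re, rule continuous_on_dot[OF continuous_on_coordinate continuous_on_kernel_op])
  ultimately have "\<exists>u\<in>sph. \<forall>w\<in>sph. Re (dot S w (?T w)) \<le> Re (dot S u (?T u))"
    by (intro continuous_attains_sup)
  then obtain u where u: "u \<in> sph"
    and max: "\<And>w. w \<in> sph \<Longrightarrow> Re (dot S w (?T w)) \<le> Re (dot S u (?T u))" by blast
  define a where "a = Re (dot S u (?T u))"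
  have uV: "u \<in> V" and u1: "dot S u u = 1" using u by (auto simp: sph_def)
  have form_le: "Re (dot S w (?T w)) \<le> a * Re (dot S w w)" if w: "w \<in> V" for w
  proof (cases "w = (\<lambda>_. 0)")
    case True
    then show ?thesis by (simp add: dot_def)
  next
    case False
    obtain s where s: "s > 0" "dot S w w = of_real (s\<^sup>2)"
        "dot S (\<lambda>n. of_real (1 / s) * w n) (\<lambda>n. of_real (1 / s) * w n) = 1"
      using normalize_in_subspace[OF fin _ False] w V(1) by blast
    have "(\<lambda>n. of_real (1 / s) * w n) \<in> sph"
      unfolding sph_def using s(3) scale[OF w] by blast
    from max[OF this] have "(1 / s)\<^sup>2 * Re (dot S w (?T w)) \<le> a"
      by (simp add: a_def kernel_op_scale dot_linear power2_eq_square flip: of_real_divide of_real_mult)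
    then show ?thesis using s by (simp add: field_simps)
  qed

  define r where "r = (\<lambda>n. ?T u n + (- of_real a) * u n)"
  have rV: "r \<in> V" unfolding r_def using inv[OF uV] uV by (rule lin)
  define R where "R = Re (dot S r r)"
  define \<beta> where "\<beta> = Re (dot S r (?T r)) - a * R"
  have "R \<ge> 0" by (simp add: R_def dot_self sum_nonneg)
  \<comment> \<open>the quadratic form \<open>\<langle>w, (T - a) w\<rangle>\<close> is nonpositive on \<open>V\<close>, evaluated at \<open>w = u + t r\<close>\<close>
  have quad: "2 * t * R + t\<^sup>2 * \<beta> \<le> 0" for t :: real
  proof -
    define w where "w = (\<lambda>n. u n + of_real t * r n)"
    have "w \<in> V" unfolding w_def by (rule lin[OF uV rV])
    have 1: "Re (dot S r u) = Re (dot S u r)"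
      using dot_cnj[of S u r] by (metis complex_cnj(1) complex.sel(1) cnj.simps(1))
    have 2: "Re (dot S u (?T r)) = Re (dot S r (?T u))"
      using dot_cnj[of S "?T u" r] kernel_op_self_adjoint[OF K, of S u r] by (metis cnj.simps(1))
    have 3: "R = Re (dot S r (?T u)) - a * Re (dot S r u)"
      unfolding R_def by (subst (2) r_def) (simp add: dot_linear)
    have "Re (dot S w (?T w)) - a * Re (dot S w w) = 2 * t * R + t\<^sup>2 * \<beta>"
      using u1 unfolding w_def
      by (simp add: kernel_op_add kernel_op_scale dot_linear 1 2 a_def[symmetric] \<beta>_def)
        (simp add: 3[unfolded 1] R_def[symmetric] 1 algebra_simps power2_eq_square)
    with form_le[OF \<open>w \<in> V\<close>] show ?thesis by linarith
  qed
  have "R = 0"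
  proof (cases "\<beta> < 0")
    case True
    \<comment> \<open>the parameter \<open>t = R / - \<beta>\<close> makes the linear term twice as large in modulus as the quadratic one\<close>
    have "2 * (R / - \<beta>) * R + (R / - \<beta>)\<^sup>2 * \<beta> = R\<^sup>2 / - \<beta>"
      using True by (simp add: field_simps power2_eq_square)
    then have "R\<^sup>2 / - \<beta> \<le> 0" using quad[of "R / - \<beta>"] by linarith
    then show ?thesis using True by (simp add: zero_le_divide_iff)
  next
    case False
    then show ?thesis using quad[of 1] \<open>R \<ge> 0\<close> by simp
  qed
  moreover have "dot S r r = of_real R" by (simp add: R_def dot_self del: of_real_sum)
  ultimately have "r = (\<lambda>_. 0)" using dot_self_eq_0_iff[OF fin, of r] rV V by auto
  then have "?T u = (\<lambda>n. of_real a * u n)" by (simp add: r_def fun_eq_iff)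
  with uV u1 show ?thesis by (rule that)
qed

text \<open>Bessel's inequality for the indicator of the site \<open>n\<close>. Summed over \<open>n \<in> S\<close> it bounds the length of an orthonormal
family by \<open>card S\<close> without any notion of dimension.\<close>

lemma Bessel_at_site:
  assumes fin: "finite S" and e: "orthonormal_eigenvectors S K N e a" and n: "n \<in> S"
  shows "(\<Sum>i<N. (cmod (e i n))\<^sup>2) \<le> 1"
proof -
  define d :: "'a \<Rightarrow> complex" where "d = (\<lambda>m. if m = n then 1 else 0)"
  \<comment> \<open>the component of \<open>d\<close> orthogonal to all \<open>e i\<close>, whose squared norm is its value at \<open>n\<close>\<close>
  define v where "v = (\<lambda>m. d m - (\<Sum>i<N. cnj (e i n) * e i m))"
  have de: "dot S (e i) d = cnj (e i n)" for i
    using dot_delta_left[OF fin n, of "e i"] dot_cnj[of S d "e i"] unfolding d_def by simp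
  have "dot S (e j) v = 0" if "j < N" for j
    using that e unfolding v_def orthonormal_eigenvectors_def
    by (simp add: dot_linear de if_distrib[of "\<lambda>x. _ * x"] cong: if_cong)
  then have "dot S v v = dot S d v"
    by (subst v_def) (simp add: dot_linear)
  also have "\<dots> = v n" using dot_delta_left[OF fin n] unfolding d_def by blast
  also have "\<dots> = of_real (1 - (\<Sum>i<N. (cmod (e i n))\<^sup>2))"
    unfolding of_real_diff of_real_sum complex_norm_square by (simp add: v_def d_def mult.commute)
  finally have "1 - (\<Sum>i<N. (cmod (e i n))\<^sup>2) = (\<Sum>n\<in>S. (cmod (v n))\<^sup>2)"
    unfolding dot_self of_real_eq_iff by simp
  then show ?thesis using sum_nonneg[of S "\<lambda>n. (cmod (v n))\<^sup>2"] by simp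
qed

lemma orthonormal_eigenvectors_le_card:
  assumes fin: "finite S" and e: "orthonormal_eigenvectors S K N e a"
  shows "N \<le> card S"
proof -
  have "(\<Sum>n\<in>S. (cmod (e i n))\<^sup>2) = 1" if "i < N" for i
  proof -
    have "dot S (e i) (e i) = 1" using e that by (simp add: orthonormal_eigenvectors_def)
    then show ?thesis unfolding dot_self using of_real_eq_1_iff by blast
  qed
  then have "real N = (\<Sum>i<N. \<Sum>n\<in>S. (cmod (e i n))\<^sup>2)" by simp
  also have "\<dots> = (\<Sum>n\<in>S. \<Sum>i<N. (cmod (e i n))\<^sup>2)" by (rule sum.swap)
  also have "\<dots> \<le> (\<Sum>n\<in>S. 1)" by (intro sum_mono Bessel_at_site[OF fin e])
  finally show ?thesis by simp
qed

text \<open>An orthonormal family of eigenvectors of maximal length spans: its orthogonal complement is invariant, and a nonzero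
complement would contain a further eigenvector.\<close>

lemma eigenbasis_exists:
  assumes fin: "finite S" and K: "hermitian_kernel K"
  obtains N e a where "eigenbasis S K N e a"
proof -
  let ?T = "kernel_op S K"
  define P where "P N \<longleftrightarrow> (\<exists>e a. orthonormal_eigenvectors S K N e a)" for N
  have "P 0" by (simp add: P_def orthonormal_eigenvectors_def)
  moreover have "\<forall>N. P N \<longrightarrow> N \<le> card S"
    using orthonormal_eigenvectors_le_card[OF fin] by (auto simp: P_def)
  ultimately obtain N where PN: "P N" and "\<And>N'. P N' \<Longrightarrow> N' \<le> N"
    using Nat.ex_has_greatest_nat[of P 0 "card S"] by auto
  then have maximal: "\<not> P (Suc N)" by fastforce
  from PN obtain e a where ea: "orthonormal_eigenvectors S K N e a" by (auto simp: P_def)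
  then have sup: "e i \<in> supported S" and eig: "?T (e i) = (\<lambda>n. of_real (a i) * e i n)" if "i < N" for i
    using that by (auto simp: orthonormal_eigenvectors_def)
  have orth: "dot S (e i) (e j) = (if i = j then 1 else 0)" if "i < N" "j < N" for i j
    using that ea by (auto simp: orthonormal_eigenvectors_def)
  define V where "V = {u \<in> supported S. \<forall>i<N. dot S (e i) u = 0}"
  have V0: "u = (\<lambda>_. 0)" if "u \<in> V" for u
  proof (rule ccontr)
    assume "u \<noteq> (\<lambda>_. 0)"
    have "V = (\<Inter>n\<in>- S. {u. u n = 0}) \<inter> (\<Inter>i\<in>{..<N}. {u. dot S (e i) u = 0})"
      by (auto simp: V_def supported_def)
    moreover have "closed \<dots>"
      by (intro closed_Int closed_INT ballI closed_Collect_eq continuous_on_dot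
          continuous_on_coordinate continuous_on_const)
    ultimately have "closed V" by simp
    moreover have "?T w \<in> V" if "w \<in> V" for w
      using that by (auto simp: V_def dot_linear eig simp flip: kernel_op_self_adjoint[OF K])
    moreover have "(\<lambda>n. v n + c * w n) \<in> V" if "v \<in> V" "w \<in> V" for v w c
      using that by (auto simp: V_def dot_linear supported_combine)
    ultimately obtain w b where w: "w \<in> V" "dot S w w = 1" "?T w = (\<lambda>n. of_real b * w n)"
      using eigenvector_in_invariant_subspace[OF fin K, of V u] \<open>u \<in> V\<close> \<open>u \<noteq> (\<lambda>_. 0)\<close>
      by (metis (no_types, lifting) V_def mem_Collect_eq subsetI)
    have we: "dot S w (e i) = 0" if "i < N" for i
      using w(1) that dot_cnj[of S "e i" w] by (simp add: V_def)
    have "orthonormal_eigenvectors S K (Suc N) (e(N := w)) (a(N := b))"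
      using w we sup eig orth unfolding orthonormal_eigenvectors_def
      by (auto simp: V_def less_Suc_eq)
    with maximal show False by (auto simp: P_def)
  qed
  have "u = (\<lambda>n. \<Sum>i<N. dot S (e i) u * e i n)" if u: "u \<in> supported S" for u
  proof -
    have "(\<lambda>n. u n - (\<Sum>i<N. dot S (e i) u * e i n)) \<in> V"
      using u sup by (auto simp: V_def supported_def dot_linear orth if_distrib[of "\<lambda>x. _ * x"] cong: if_cong)
    from V0[OF this] show ?thesis by (simp add: fun_eq_iff)
  qed
  with ea have "eigenbasis S K N e a" by (auto simp: eigenbasis_def)
  then show ?thesis by (rule that)
qed

section \<open>Traces under diagonal perturbations\<close>

lemma eigenbasis_expand:
  assumes "eigenbasis S K N e a" "v \<in> supported S"
  shows "dot S u v = (\<Sum>i<N. dot S u (e i) * dot S (e i) v)"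
proof -
  have v: "v = (\<lambda>n. \<Sum>i<N. dot S (e i) v * e i n)"
    using assms unfolding eigenbasis_def by blast
  have "dot S u v = dot S u (\<lambda>n. \<Sum>i<N. dot S (e i) v * e i n)"
    using v by (rule arg_cong)
  then show ?thesis unfolding dot_sum_right dot_scale_right by (simp only: mult.commute)
qed

lemma eigenbasis_Parseval:
  assumes "eigenbasis S K N e a" "u \<in> supported S"
  shows "(\<Sum>i<N. (cmod (dot S (e i) u))\<^sup>2) = Re (dot S u u)"
proof -
  have "dot S u u = of_real (\<Sum>i<N. (cmod (dot S (e i) u))\<^sup>2)"
    unfolding eigenbasis_expand[OF assms, of u] of_real_sum complex_norm_square
    by (simp add: dot_cnj mult.commute)
  then show ?thesis by simp
qed

lemma eigenbasis_sum_at_site: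
  assumes "finite S" "eigenbasis S K N e a" "n \<in> S"
  shows "(\<Sum>i<N. (cmod (e i n))\<^sup>2) = 1"
proof -
  define d :: "'a \<Rightarrow> complex" where "d = (\<lambda>m. if m = n then 1 else 0)"
  have "dot S d u = u n" for u unfolding d_def by (rule dot_delta_left[OF assms(1,3)])
  then have "dot S (e i) d = cnj (e i n)" "Re (dot S d d) = 1" for i
    using dot_cnj[of S d "e i"] by (simp_all add: d_def)
  moreover have "d \<in> supported S" using assms(3) by (simp add: d_def supported_def)
  ultimately show ?thesis using eigenbasis_Parseval[OF assms(2), of d] by simp
qed

lemma eigenbasis_quadratic_form:
  assumes K: "hermitian_kernel K" and e: "eigenbasis S K N e a" and u: "u \<in> supported S"
  shows "(\<Sum>i<N. a i * (cmod (dot S (e i) u))\<^sup>2) = Re (dot S u (kernel_op S K u))"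
proof -
  have "dot S (e i) (kernel_op S K u) = of_real (a i) * dot S (e i) u" if "i < N" for i
    using e that unfolding kernel_op_self_adjoint[OF K, symmetric]
    by (simp add: eigenbasis_def orthonormal_eigenvectors_def dot_linear)
  then have "dot S u (kernel_op S K u)
      = (\<Sum>i<N. of_real (a i) * (dot S (e i) u * cnj (dot S (e i) u)))"
    unfolding eigenbasis_expand[OF e kernel_op_supported, of u K u]
    by (intro sum.cong) (auto simp: dot_cnj)
  then show ?thesis by (simp flip: complex_norm_square of_real_mult)
qed

text \<open>Klein's inequality. With \<open>p i j = \<bar>\<langle>e i, f j\<rangle>\<bar>\<^sup>2\<close>, a doubly stochastic matrix, the difference of the traces is
\<open>\<Sum>i j. p i j * (h (a i) - h (b j))\<close>. The tangent-line inequality bounds each term below by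
\<open>p i j * h' (b j) * (a i - b j)\<close>, and summing over \<open>i\<close> leaves the expectation of the perturbation in the vector
\<open>f j\<close>, which for a diagonal perturbation is \<open>\<Sum>n. D n * \<bar>f j n\<bar>\<^sup>2\<close>. Since \<open>\<Sum>j. \<bar>f j n\<bar>\<^sup>2 = 1\<close>, every entry
\<open>D n\<close> is counted once.\<close>

lemma trace_tangent_lower_bound:
  fixes D :: "'i \<Rightarrow> real"
  assumes fin: "finite S"
    and K: "hermitian_kernel K" and e: "eigenbasis S K N e a"
    and f: "eigenbasis S K' N' f b"
    and perturbation: "\<And>n m. K n m = K' n m + (if n = m then of_real (D n) else 0)"
    and tangent: "\<And>x y. h' y * (x - y) \<le> h x - h y" and C: "\<And>y. \<bar>h' y\<bar> \<le> C"
  shows "- (C * (\<Sum>n\<in>S. \<bar>D n\<bar>)) \<le> (\<Sum>i<N. h (a i)) - (\<Sum>j<N'. h (b j))"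
proof -
  define p where "p i j = (cmod (dot S (e i) (f j)))\<^sup>2" for i j
  have e_sup: "e i \<in> supported S" "dot S (e i) (e i) = 1" if "i < N" for i
    using e that by (auto simp: eigenbasis_def orthonormal_eigenvectors_def)
  have f_sup: "f j \<in> supported S" "dot S (f j) (f j) = 1"
      "kernel_op S K' (f j) = (\<lambda>n. of_real (b j) * f j n)" if "j < N'" for j
    using f that by (auto simp: eigenbasis_def orthonormal_eigenvectors_def)
  have "cmod (dot S (e i) (f j)) = cmod (dot S (f j) (e i))" for i j
    by (metis complex_mod_cnj dot_cnj)
  then have row: "(\<Sum>j<N'. p i j) = 1" if "i < N" for i
    using eigenbasis_Parseval[OF f e_sup(1)[OF that]] e_sup(2)[OF that] by (simp add: p_def)
  have col: "(\<Sum>i<N. p i j) = 1" if "j < N'" for j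
    using eigenbasis_Parseval[OF e f_sup(1)[OF that]] f_sup(2)[OF that] by (simp add: p_def)
  have mean: "(\<Sum>i<N. p i j * a i) = b j + (\<Sum>n\<in>S. D n * (cmod (f j n))\<^sup>2)" if j: "j < N'" for j
  proof -
    have "kernel_op S K (f j) = (\<lambda>n. of_real (b j) * f j n + of_real (D n) * f j n)"
    proof
      fix n
      have "kernel_op S K (f j) n = kernel_op S K' (f j) n + of_real (D n) * f j n"
      proof (cases "n \<in> S")
        case True
        then show ?thesis using fin unfolding kernel_op_def
          by (simp add: perturbation distrib_right sum.distrib if_distrib[of "\<lambda>x. x * _"] cong: if_cong)
      next
        case False
        then show ?thesis using f_sup(1)[OF j] by (simp add: kernel_op_def supported_def)
      qed
      then show "kernel_op S K (f j) n = of_real (b j) * f j n + of_real (D n) * f j n"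
        by (simp add: f_sup(3)[OF j])
    qed
    moreover have "dot S (f j) (\<lambda>n. of_real (D n) * f j n) = of_real (\<Sum>n\<in>S. D n * (cmod (f j n))\<^sup>2)"
      unfolding dot_def of_real_sum of_real_mult complex_norm_square by (simp add: mult_ac)
    ultimately have "Re (dot S (f j) (kernel_op S K (f j))) = b j + (\<Sum>n\<in>S. D n * (cmod (f j n))\<^sup>2)"
      by (simp add: dot_linear f_sup(2)[OF j] del: of_real_sum)
    then show ?thesis
      using eigenbasis_quadratic_form[OF K e f_sup(1)[OF j]] by (simp add: p_def mult.commute)
  qed

  have "\<bar>\<Sum>j<N'. h' (b j) * (\<Sum>n\<in>S. D n * (cmod (f j n))\<^sup>2)\<bar>
      \<le> (\<Sum>j<N'. C * (\<Sum>n\<in>S. \<bar>D n\<bar> * (cmod (f j n))\<^sup>2))"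
  proof (rule order_trans[OF sum_abs], rule sum_mono)
    fix j
    have "\<bar>\<Sum>n\<in>S. D n * (cmod (f j n))\<^sup>2\<bar> \<le> (\<Sum>n\<in>S. \<bar>D n\<bar> * (cmod (f j n))\<^sup>2)"
      by (rule order_trans[OF sum_abs]) (simp add: abs_mult)
    moreover have "0 \<le> C" using C[of 0] by linarith
    ultimately show "\<bar>h' (b j) * (\<Sum>n\<in>S. D n * (cmod (f j n))\<^sup>2)\<bar>
        \<le> C * (\<Sum>n\<in>S. \<bar>D n\<bar> * (cmod (f j n))\<^sup>2)"
      unfolding abs_mult using C by (intro mult_mono) auto
  qed
  also have "\<dots> = C * (\<Sum>n\<in>S. \<bar>D n\<bar> * (\<Sum>j<N'. (cmod (f j n))\<^sup>2))"
    unfolding sum_distrib_left by (rule sum.swap)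
  also have "\<dots> = C * (\<Sum>n\<in>S. \<bar>D n\<bar>)"
    by (simp add: eigenbasis_sum_at_site[OF fin f])
  finally have "- (C * (\<Sum>n\<in>S. \<bar>D n\<bar>)) \<le> (\<Sum>j<N'. h' (b j) * (\<Sum>n\<in>S. D n * (cmod (f j n))\<^sup>2))"
    by linarith
  also have "\<dots> = (\<Sum>j<N'. h' (b j) * ((\<Sum>i<N. p i j * a i) - b j * (\<Sum>i<N. p i j)))"
    by (intro sum.cong) (auto simp: mean col)
  also have "\<dots> = (\<Sum>j<N'. \<Sum>i<N. p i j * (h' (b j) * (a i - b j)))"
    by (simp add: sum_distrib_left sum_subtractf[symmetric] algebra_simps)
  also have "\<dots> \<le> (\<Sum>j<N'. \<Sum>i<N. p i j * (h (a i) - h (b j)))"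
    by (intro sum_mono mult_left_mono tangent) (simp add: p_def)
  also have "\<dots> = (\<Sum>j<N'. \<Sum>i<N. p i j * h (a i)) - (\<Sum>j<N'. \<Sum>i<N. p i j * h (b j))"
    by (simp add: right_diff_distrib sum_subtractf)
  also have "(\<Sum>j<N'. \<Sum>i<N. p i j * h (a i)) = (\<Sum>i<N. h (a i))"
    by (subst sum.swap) (simp add: row flip: sum_distrib_right)
  also have "(\<Sum>j<N'. \<Sum>i<N. p i j * h (b j)) = (\<Sum>j<N'. h (b j))"
    by (simp add: col flip: sum_distrib_right)
  finally show ?thesis .
qed

text \<open>These hypotheses are symmetric under exchanging the two kernels and replacing \<open>D\<close> by \<open>- D\<close>, which turns the
one-sided trace inequality into a two-sided one.\<close>

locale diagonal_perturbation =
  fixes S :: "'i set" and K K' :: "'i \<Rightarrow> 'i \<Rightarrow> complex" and D :: "'i \<Rightarrow> real"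
    and N N' :: nat and e f :: "nat \<Rightarrow> 'i \<Rightarrow> complex" and a b :: "nat \<Rightarrow> real"
  assumes finite_S: "finite S"
    and hermitian: "hermitian_kernel K" "hermitian_kernel K'"
    and eigenbases: "eigenbasis S K N e a" "eigenbasis S K' N' f b"
    and diagonal: "\<And>n m. K n m = K' n m + (if n = m then of_real (D n) else 0)"
begin

lemma trace_convex_diff_le:
  assumes "\<And>x y. h' y * (x - y) \<le> h x - h y" "\<And>y. \<bar>h' y\<bar> \<le> C"
  shows "\<bar>(\<Sum>i<N. h (a i)) - (\<Sum>j<N'. h (b j))\<bar> \<le> C * (\<Sum>n\<in>S. \<bar>D n\<bar>)"
proof -
  have reverse: "K' n m = K n m + (if n = m then of_real (- D n) else 0)" for n m
    by (simp add: diagonal)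
  show ?thesis
    using trace_tangent_lower_bound[OF finite_S hermitian(1) eigenbases diagonal assms]
      trace_tangent_lower_bound[OF finite_S hermitian(2) eigenbases(2,1) reverse assms]
    by simp
qed

text \<open>Both \<open>\<phi> + g\<close> and \<open>g\<close> are convex with bounded derivative for \<open>g x = c * (x * arctan x - ln (1 + x\<^sup>2) / 2)\<close>, since
\<open>g'' x = c / (1 + x\<^sup>2)\<close> dominates \<open>\<bar>\<phi>'' x\<bar>\<close> and \<open>g' x = c * arctan x\<close>. Hence \<open>\<phi>\<close> inherits the estimate as
their difference.\<close>

lemma trace_C2_diff_le:
  assumes \<phi>: "\<And>x. (\<phi> has_real_derivative \<phi>' x) (at x)"
    and \<phi>': "\<And>x. (\<phi>' has_real_derivative \<phi>'' x) (at x)"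
    and C: "\<And>x. \<bar>\<phi>' x\<bar> \<le> C" and c: "\<And>x. \<bar>\<phi>'' x\<bar> * (1 + x\<^sup>2) \<le> c"
  shows "\<bar>(\<Sum>i<N. \<phi> (a i)) - (\<Sum>j<N'. \<phi> (b j))\<bar> \<le> (C + 4 * c) * (\<Sum>n\<in>S. \<bar>D n\<bar>)"
proof -
  have "c \<ge> 0" using c[of 0] by simp
  have pos: "1 + x\<^sup>2 > 0" for x :: real by (simp add: add_pos_nonneg)
  define g where "g x = c * (x * arctan x - ln (1 + x\<^sup>2) / 2)" for x
  have g: "(g has_real_derivative c * arctan x) (at x)" for x
    unfolding g_def using pos[of x]
    by (auto intro!: derivative_eq_intros simp: divide_simps power2_eq_square)
  have g': "((\<lambda>x. c * arctan x) has_real_derivative c / (1 + x\<^sup>2)) (at x)" for x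
    by (auto intro!: derivative_eq_intros simp: divide_inverse)
  have arctan: "\<bar>c * arctan x\<bar> \<le> 2 * c" for x
  proof -
    have "\<bar>arctan x\<bar> \<le> 2" using arctan_bounded[of x] pi_less_4 by linarith
    then show ?thesis using mult_right_mono[of "\<bar>arctan x\<bar>" 2 c] \<open>c \<ge> 0\<close> by (simp add: abs_mult mult.commute)
  qed
  have "- \<phi>'' x \<le> c / (1 + x\<^sup>2)" for x
  proof -
    have "- \<phi>'' x * (1 + x\<^sup>2) \<le> \<bar>\<phi>'' x\<bar> * (1 + x\<^sup>2)" by (intro mult_right_mono) auto
    then show ?thesis using c[of x] pos[of x] by (simp add: pos_le_divide_eq)
  qed
  then have conv: "0 \<le> \<phi>'' x + c / (1 + x\<^sup>2)" for x by (smt (verit))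
  have "\<bar>(\<Sum>i<N. \<phi> (a i) + g (a i)) - (\<Sum>j<N'. \<phi> (b j) + g (b j))\<bar> \<le> (C + 2 * c) * (\<Sum>n\<in>S. \<bar>D n\<bar>)"
  proof (rule trace_convex_diff_le[where h' = "\<lambda>x. \<phi>' x + c * arctan x"])
    show "(\<phi>' y + c * arctan y) * (x - y) \<le> \<phi> x + g x - (\<phi> y + g y)" for x y
      by (rule f''_imp_f'[where C = UNIV and f = "\<lambda>x. \<phi> x + g x" and f'' = "\<lambda>x. \<phi>'' x + c / (1 + x\<^sup>2)"])
        (auto intro: DERIV_add \<phi> \<phi>' g g' conv)
    show "\<bar>\<phi>' y + c * arctan y\<bar> \<le> C + 2 * c" for y using C[of y] arctan[of y] by linarith
  qed
  moreover have "\<bar>(\<Sum>i<N. g (a i)) - (\<Sum>j<N'. g (b j))\<bar> \<le> (2 * c) * (\<Sum>n\<in>S. \<bar>D n\<bar>)"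
  proof (rule trace_convex_diff_le[where h' = "\<lambda>x. c * arctan x"])
    show "c * arctan y * (x - y) \<le> g x - g y" for x y
      by (rule f''_imp_f'[where C = UNIV and f'' = "\<lambda>x. c / (1 + x\<^sup>2)"])
        (use \<open>c \<ge> 0\<close> pos in \<open>auto intro: g g' simp: less_imp_le\<close>)
  qed (rule arctan)
  ultimately show ?thesis by (simp add: sum.distrib algebra_simps)
qed

end

section \<open>The spectral counting measure in terms of eigenvalues\<close>

text \<open>On a finite set, square summability is automatic and the infinite sums of the inner product are finite, so the
Hilbert space notions agree with the finite-dimensional ones above.\<close>

lemma ell2_on_finite: "finite S \<Longrightarrow> ell2_on S = supported S" for S :: "('d::finite) site set"
proof -
  assume fin: "finite S"
  have "(\<lambda>n. (cmod (u n))\<^sup>2) summable_on UNIV" if "u \<in> supported S" for u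
    by (rule finite_nonzero_values_imp_summable_on, rule finite_subset[OF _ fin])
      (use that in \<open>auto simp: supported_def\<close>)
  then show ?thesis by (auto simp: ell2_on_def supported_def)
qed

lemma ell2_inner_eq_dot:
  fixes u :: "('d::finite) wave"
  assumes "finite S" "u \<in> supported S"
  shows "ell2_inner u v = dot S u v"
proof -
  have "ell2_inner u v = (\<Sum>\<^sub>\<infinity>n\<in>S. cnj (u n) * v n)"
    unfolding ell2_inner_def using assms(2) by (intro infsum_cong_neutral) (auto simp: supported_def)
  then show ?thesis using assms(1) by (simp add: dot_def)
qed

lemma finite_vec_box: "(\<And>i. finite (A i)) \<Longrightarrow> finite {x :: int ^ 'd::finite. \<forall>i. x $ i \<in> A i}"
  and card_vec_box: "(\<And>i. finite (A i)) \<Longrightarrow> card {x :: int ^ 'd::finite. \<forall>i. x $ i \<in> A i} = (\<Prod>i\<in>UNIV. card (A i))"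
proof -
  assume fin: "\<And>i. finite (A i)"
  have eq: "{x :: int ^ 'd. \<forall>i. x $ i \<in> A i} = vec_lambda ` (PiE UNIV A)"
  proof (intro set_eqI iffI)
    fix x :: "int ^ 'd" assume "x \<in> {x. \<forall>i. x $ i \<in> A i}"
    then have "vec_nth x \<in> PiE UNIV A" by auto
    then show "x \<in> vec_lambda ` (PiE UNIV A)"
      by (rule rev_image_eqI) (simp add: vec_lambda_eta)
  qed auto
  have inj: "inj_on (vec_lambda :: ('d \<Rightarrow> int) \<Rightarrow> _) X" for X
    by (auto intro: inj_onI simp: vec_lambda_inject)
  show "finite {x :: int ^ 'd. \<forall>i. x $ i \<in> A i}"
    unfolding eq using fin by (intro finite_imageI finite_PiE) auto
  show "card {x :: int ^ 'd. \<forall>i. x $ i \<in> A i} = (\<Prod>i\<in>UNIV. card (A i))"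
    unfolding eq by (simp add: card_image[OF inj] card_PiE)
qed

lemma box_eq: "box L = {n :: int ^ 'd::finite. \<forall>i. n $ i \<in> {- \<lfloor>L\<rfloor>..\<lfloor>L\<rfloor>}}"
proof -
  have "real_of_int \<bar>x\<bar> \<le> L \<longleftrightarrow> x \<in> {- \<lfloor>L\<rfloor>..\<lfloor>L\<rfloor>}" for x
    by (simp add: le_floor_iff[symmetric] abs_le_iff) linarith
  then show ?thesis unfolding box_def by blast
qed

lemma finite_box: "finite (box L)"
  unfolding box_eq by (rule finite_vec_box) simp

lemma card_box_of_nat: "card (box (real m) :: ('d::finite) site set) = (2 * m + 1) ^ CARD('d)"
  unfolding box_eq by (subst card_vec_box) (auto simp: nat_add_distrib nat_mult_distrib)

lemma finite_neighbours: "finite {m :: int ^ 'd::finite. (\<Sum>i\<in>UNIV. \<bar>m $ i - n $ i\<bar>) = 1}"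
proof (rule finite_subset)
  show "finite {m :: int ^ 'd. \<forall>i. m $ i \<in> {n $ i - 1..n $ i + 1}}"
    by (rule finite_vec_box) simp
  have "\<bar>m $ i - n $ i\<bar> \<le> (\<Sum>i\<in>UNIV. \<bar>m $ i - n $ i\<bar>)" for m :: "int ^ 'd" and i
    by (rule member_le_sum) auto
  then show "{m :: int ^ 'd. (\<Sum>i\<in>UNIV. \<bar>m $ i - n $ i\<bar>) = 1} \<subseteq> {m. \<forall>i. m $ i \<in> {n $ i - 1..n $ i + 1}}"
    by (auto simp: abs_le_iff) (smt (verit))+
qed

text \<open>The matrix of the operator \<open>(L + 1) * (H - E)\<close> in the basis of the sites.\<close>

definition hamiltonian_kernel ::
    "real \<Rightarrow> real \<Rightarrow> (('d::finite) site \<Rightarrow> real) \<Rightarrow> 'd site \<Rightarrow> 'd site \<Rightarrow> complex" where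
  "hamiltonian_kernel L E V n m = of_real (L + 1) *
     ((if (\<Sum>i\<in>UNIV. \<bar>m $ i - n $ i\<bar>) = 1 then 1 else 0) + (if n = m then of_real (V n - E) else 0))"

lemma hermitian_hamiltonian_kernel: "hermitian_kernel (hamiltonian_kernel L E V)"
  unfolding hermitian_kernel_def hamiltonian_kernel_def by (simp add: abs_minus_commute)

lemma scaled_compression_hamiltonian:
  fixes V :: "('d::finite) site \<Rightarrow> real"
  shows "scaled_compression L E (hamiltonian V) = kernel_op (box L) (hamiltonian_kernel L E V)"
proof (intro ext)
  fix u :: "'d wave" and n :: "'d site"
  let ?nb = "{m :: 'd site. (\<Sum>i\<in>UNIV. \<bar>m $ i - n $ i\<bar>) = 1}"
  have fin: "finite (box L :: 'd site set)" by (rule finite_box)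
  show "scaled_compression L E (hamiltonian V) u n = kernel_op (box L) (hamiltonian_kernel L E V) u n"
  proof (cases "n \<in> box L")
    case True
    have "lattice_laplacian (restrict_to (box L) u) n = (\<Sum>m\<in>?nb \<inter> box L. u m)"
      unfolding lattice_laplacian_def restrict_to_def
      using finite_neighbours[of n] by (simp add: sum.inter_restrict)
    also have "\<dots> = (\<Sum>m\<in>box L. (if (\<Sum>i\<in>UNIV. \<bar>m $ i - n $ i\<bar>) = 1 then 1 else 0) * u m)"
      using fin
      by (simp add: Int_commute[of ?nb] sum.inter_restrict if_distrib[of "\<lambda>x. x * _"] cong: if_cong)
    moreover have "of_real (V n) * u n - of_real E * u n
        = (\<Sum>m\<in>box L. (if n = m then of_real (V n - E) else 0) * u m)"
      using True fin
      by (simp add: if_distrib[of "\<lambda>x. x * _"] left_diff_distrib cong: if_cong)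
    ultimately show ?thesis using True
      by (simp add: scaled_compression_def hamiltonian_def kernel_op_def hamiltonian_kernel_def
          restrict_to_def sum_distrib_left[symmetric] distrib_right sum.distrib mult.assoc)
  qed (simp add: scaled_compression_def restrict_to_def kernel_op_def)
qed

text \<open>In an orthonormal eigenbasis the spectral projection of \<open>B\<close> keeps the coefficients with eigenvalue in \<open>B\<close>, and its
trace counts these eigenvalues.\<close>

context
  fixes S :: "('d::finite) site set" and K N e a
  assumes fin: "finite S" and K: "hermitian_kernel K" and e: "eigenbasis S K N e a"
begin

lemma eigenspace_on_eq:
  "eigenspace_on S (kernel_op S K) x = {u \<in> supported S. \<forall>i<N. a i \<noteq> x \<longrightarrow> dot S (e i) u = 0}"
proof -
  have T: "dot S (e i) (kernel_op S K u) = of_real (a i) * dot S (e i) u" if "i < N" for i u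
    using e that unfolding kernel_op_self_adjoint[OF K, symmetric]
    by (simp add: eigenbasis_def orthonormal_eigenvectors_def dot_linear)
  have "kernel_op S K u = (\<lambda>n. of_real x * u n) \<longleftrightarrow> (\<forall>i<N. a i \<noteq> x \<longrightarrow> dot S (e i) u = 0)"
    if u: "u \<in> supported S" for u
  proof (intro iffI allI impI)
    fix i assume "kernel_op S K u = (\<lambda>n. of_real x * u n)" "i < N" "a i \<noteq> x"
    then show "dot S (e i) u = 0" using T[of i u] by (simp add: dot_linear)
  next
    assume *: "\<forall>i<N. a i \<noteq> x \<longrightarrow> dot S (e i) u = 0"
    have "kernel_op S K u = (\<lambda>n. \<Sum>i<N. dot S (e i) (kernel_op S K u) * e i n)"
      using e kernel_op_supported unfolding eigenbasis_def by blast
    also have "\<dots> = (\<lambda>n. \<Sum>i<N. of_real x * (dot S (e i) u * e i n))"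
      using * by (intro ext sum.cong refl) (auto simp: T)
    also have "\<dots> = (\<lambda>n. of_real x * (\<Sum>i<N. dot S (e i) u * e i n))"
      by (simp add: sum_distrib_left)
    also have "(\<lambda>n. \<Sum>i<N. dot S (e i) u * e i n) = u"
      using e u unfolding eigenbasis_def by metis
    then have "(\<lambda>n. of_real x * (\<Sum>i<N. dot S (e i) u * e i n)) = (\<lambda>n. of_real x * u n)"
      by metis
    finally show "kernel_op S K u = (\<lambda>n. of_real x * u n)" .
  qed
  then show ?thesis unfolding eigenspace_on_def ell2_on_finite[OF fin] by blast
qed

lemma orth_proj_eigenspace:
  assumes u: "u \<in> supported S"
  shows "orth_proj (eigenspace_on S (kernel_op S K) x) u
    = (\<lambda>n. \<Sum>i<N. if a i = x then dot S (e i) u * e i n else 0)"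
proof -
  define W where "W = eigenspace_on S (kernel_op S K) x"
  define v0 where "v0 = (\<lambda>n. \<Sum>i<N. (if a i = x then dot S (e i) u else 0) * e i n)"
  have W: "w \<in> W \<longleftrightarrow> w \<in> supported S \<and> (\<forall>i<N. a i \<noteq> x \<longrightarrow> dot S (e i) w = 0)" for w
    unfolding W_def eigenspace_on_eq by blast
  have dv0: "dot S (e i) v0 = (if a i = x then dot S (e i) u else 0)" if "i < N" for i
  proof -
    have "dot S (e i) v0 = (\<Sum>j<N. (if a j = x then dot S (e j) u else 0) * (if i = j then 1 else 0))"
      unfolding v0_def dot_linear using e that
      by (intro sum.cong refl) (auto simp: eigenbasis_def orthonormal_eigenvectors_def)
    also have "\<dots> = (if a i = x then dot S (e i) u else 0)"
      using that by (simp add: if_distrib[of "\<lambda>x. _ * x"] cong: if_cong)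
    finally show ?thesis .
  qed
  have v0_sup: "v0 \<in> supported S"
    using e by (auto simp: v0_def supported_def eigenbasis_def orthonormal_eigenvectors_def)
  then have v0W: "v0 \<in> W" by (simp add: W dv0)
  have inner: "ell2_inner w v = dot S w v" if "w \<in> W" for w v
    using that by (intro ell2_inner_eq_dot fin) (simp add: W)
  have orth: "dot S w (\<lambda>n. u n - v0 n) = 0" if w: "w \<in> W" for w
  proof -
    have "(\<lambda>n. u n - v0 n) \<in> supported S" using u v0_sup by (simp add: supported_def)
    moreover have "dot S w (e i) * dot S (e i) (\<lambda>n. u n - v0 n) = 0" if "i < N" for i
      using w that dot_cnj[of S "e i" w] by (auto simp: dot_linear dv0 W)
    ultimately show ?thesis by (subst eigenbasis_expand[OF e]) (auto intro!: sum.neutral)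
  qed
  have "orth_proj W u = v0"
    unfolding orth_proj_def
  proof (rule the_equality)
    show "v0 \<in> W \<and> (\<forall>w\<in>W. ell2_inner w (\<lambda>n. u n - v0 n) = 0)"
      using v0W orth by (simp add: inner)
  next
    fix v assume v: "v \<in> W \<and> (\<forall>w\<in>W. ell2_inner w (\<lambda>n. u n - v n) = 0)"
    define w where "w = (\<lambda>n. v0 n - v n)"
    have "w \<in> W" using v v0W by (auto simp: W w_def dot_linear supported_def)
    then have "dot S w (\<lambda>n. u n - v n) = 0" "dot S w (\<lambda>n. u n - v0 n) = 0"
      using v orth inner by auto
    then have "dot S w w = 0" by (subst (2) w_def) (simp add: dot_linear)
    then have "w = (\<lambda>_. 0)" using \<open>w \<in> W\<close> dot_self_eq_0_iff[OF fin, of w] by (simp add: W)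
    then show "v = v0" by (simp add: w_def fun_eq_iff)
  qed
  then show ?thesis by (simp add: W_def v0_def if_distrib[of "\<lambda>x. x * _"] cong: if_cong)
qed

lemma eigenspace_nontrivial_iff:
  "eigenspace_on S (kernel_op S K) x \<noteq> {\<lambda>_. 0} \<longleftrightarrow> x \<in> a ` {..<N}"
proof
  assume "x \<in> a ` {..<N}"
  then obtain i where i: "i < N" "x = a i" by blast
  then have "e i \<in> eigenspace_on S (kernel_op S K) x" "dot S (e i) (e i) = 1"
    using e by (auto simp: eigenspace_on_eq eigenbasis_def orthonormal_eigenvectors_def)
  moreover have "e i \<noteq> (\<lambda>_. 0)" using calculation(2) by (auto simp: dot_def)
  ultimately show "eigenspace_on S (kernel_op S K) x \<noteq> {\<lambda>_. 0}" by blast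
next
  assume nontrivial: "eigenspace_on S (kernel_op S K) x \<noteq> {\<lambda>_. 0}"
  show "x \<in> a ` {..<N}"
  proof (rule ccontr)
    assume "x \<notin> a ` {..<N}"
    then have zero: "dot S (e i) u = 0" if "u \<in> eigenspace_on S (kernel_op S K) x" "i < N" for u i
      using that by (auto simp: eigenspace_on_eq)
    have "u = (\<lambda>_. 0)" if u: "u \<in> eigenspace_on S (kernel_op S K) x" for u
    proof -
      have "u = (\<lambda>n. \<Sum>i<N. dot S (e i) u * e i n)"
        using e u unfolding eigenbasis_def eigenspace_on_eq by blast
      also have "\<dots> = (\<lambda>_. 0)" using zero[OF u] by (simp add: sum.neutral)
      finally show ?thesis .
    qed
    moreover have "(\<lambda>_. 0) \<in> eigenspace_on S (kernel_op S K) x"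
      by (simp add: eigenspace_on_eq supported_def dot_def)
    ultimately show False using nontrivial by blast
  qed
qed

lemma trace_spectral_proj:
  "trace_on S (spectral_proj S (kernel_op S K) B) = of_nat (card {i \<in> {..<N}. a i \<in> B})"
proof -
  have P: "spectral_proj S (kernel_op S K) B u n = (\<Sum>i | i < N \<and> a i \<in> B. dot S (e i) u * e i n)"
    if u: "u \<in> supported S" for u n
  proof -
    have "{x \<in> B. eigenspace_on S (kernel_op S K) x \<noteq> {\<lambda>_. 0}} = a ` {i. i < N \<and> a i \<in> B}"
      by (auto simp: eigenspace_nontrivial_iff)
    then have "spectral_proj S (kernel_op S K) B u n =
        (\<Sum>x\<in>a ` {i. i < N \<and> a i \<in> B}. \<Sum>i<N. if a i = x then dot S (e i) u * e i n else 0)"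
      by (simp add: spectral_proj_def orth_proj_eigenspace[OF u])
    also have "\<dots> = (\<Sum>i<N. \<Sum>x\<in>a ` {i. i < N \<and> a i \<in> B}. if a i = x then dot S (e i) u * e i n else 0)"
      by (rule sum.swap)
    also have "\<dots> = (\<Sum>i<N. if a i \<in> B then dot S (e i) u * e i n else 0)"
      by (intro sum.cong) auto
    also have "\<dots> = (\<Sum>i | i < N \<and> a i \<in> B. dot S (e i) u * e i n)"
      by (simp flip: sum.inter_filter add: Collect_conj_eq lessThan_def)
    finally show ?thesis .
  qed
  have d: "delta n \<in> supported S" "dot S (delta n) u = u n" "dot S u (delta n) = cnj (u n)"
    if "n \<in> S" for n u
    using that dot_delta_left[OF fin that, of u] dot_cnj[of S "delta n" u]
    by (auto simp: delta_def supported_def)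
  have "trace_on S (spectral_proj S (kernel_op S K) B)
      = (\<Sum>n\<in>S. \<Sum>i | i < N \<and> a i \<in> B. cnj (e i n) * e i n)"
    unfolding trace_on_def by (intro sum.cong refl) (simp add: ell2_inner_eq_dot[OF fin] d P)
  also have "\<dots> = (\<Sum>i | i < N \<and> a i \<in> B. dot S (e i) (e i))"
    unfolding dot_def by (rule sum.swap)
  also have "\<dots> = (\<Sum>i | i < N \<and> a i \<in> B. 1)"
    using e by (intro sum.cong refl) (auto simp: eigenbasis_def orthonormal_eigenvectors_def)
  finally show ?thesis by simp
qed

end

text \<open>The set function in the definition agrees with a weighted sum of point masses at the eigenvalues. In particular it is
countably additive, so the measure built from it takes the prescribed values.\<close>

lemma integral_spectral_counting_measure:
  fixes A :: "('d::finite) wave \<Rightarrow> 'd wave" and f :: "real \<Rightarrow> complex"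
  assumes L: "L > 0" and A: "scaled_compression L E A = kernel_op (box L) K"
    and K: "hermitian_kernel K" and e: "eigenbasis (box L) K N e a"
    and f[measurable]: "f \<in> borel_measurable borel"
  shows "(\<integral>x. f x \<partial>spectral_counting_measure L E A)
    = of_real (1 / (2 * L + 1) ^ (CARD('d) - 1)) * (\<Sum>i<N. f (a i))"
proof -
  define c where "c = 1 / (2 * L + 1) ^ (CARD('d) - 1)"
  have "c \<ge> 0" using L by (simp add: c_def)
  define P where "P = distr (point_measure {..<N} (\<lambda>_. ennreal c)) borel a"
  have "spectral_counting_measure L E A = measure_of UNIV (sets borel) (emeasure P)"
    unfolding spectral_counting_measure_def
  proof (rule measure_of_eq)
    fix B assume "B \<in> sigma_sets UNIV (sets borel :: real set set)"
    then have B: "B \<in> sets borel" using sets.sigma_sets_eq[of "borel :: real measure"] by simp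
    have "emeasure P B = emeasure (point_measure {..<N} (\<lambda>_. ennreal c)) {i \<in> {..<N}. a i \<in> B}"
      unfolding P_def using B by (subst emeasure_distr) (auto simp: space_point_measure intro!: arg_cong[where f = "emeasure _"])
    also have "\<dots> = ennreal (c * real (card {i \<in> {..<N}. a i \<in> B}))"
      using \<open>c \<ge> 0\<close> by (subst emeasure_point_measure_finite) (auto simp: ennreal_mult ennreal_of_nat_eq_real_of_nat mult.commute)
    finally show "ennreal (1 / (2 * L + 1) ^ (CARD('d) - 1) *
        Re (trace_on (box L) (spectral_proj (box L) (scaled_compression L E A) B))) = emeasure P B"
      unfolding A trace_spectral_proj[OF finite_box K e] by (simp add: c_def)
  qed simp
  also have "\<dots> = P"
    using measure_of_of_measure[of P] by (simp add: P_def)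
  finally have "(\<integral>x. f x \<partial>spectral_counting_measure L E A) = (\<integral>x. f x \<partial>P)" by simp
  also have "\<dots> = (\<integral>i. f (a i) \<partial>point_measure {..<N} (\<lambda>_. ennreal c))"
    unfolding P_def by (rule integral_distr) auto
  also have "\<dots> = (\<Sum>i<N. c *\<^sub>R f (a i))"
    unfolding point_measure_def using \<open>c \<ge> 0\<close>
    by (subst integral_density) (auto simp: lebesgue_integral_count_space_finite scaleR_sum_right)
  finally show ?thesis by (simp add: c_def scaleR_conv_of_real sum_distrib_left)
qed

section \<open>Test functions of perturbed Hamiltonians\<close>

lemma test_function_derivative:
  assumes "f \<in> test_functions"
  shows "(nth_deriv k f has_vector_derivative nth_deriv (Suc k) f x) (at x)"
  using assms unfolding test_functions_def
  by (simp add: vector_derivative_works[symmetric] nth_deriv_def)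

lemma test_function_support:
  assumes f: "f \<in> test_functions" and x: "x \<notin> closure {x. f x \<noteq> 0}"
  shows "nth_deriv k f x = 0"
  using x
proof (induction k arbitrary: x)
  case 0
  then show ?case using closure_subset[of "{x. f x \<noteq> 0}"] by (auto simp: nth_deriv_def)
next
  case (Suc k)
  have "(nth_deriv k f has_vector_derivative 0) (at x)"
    by (rule has_vector_derivative_transform_within_open[of "\<lambda>_. 0", where S = "- closure {x. f x \<noteq> 0}"])
      (use Suc in auto)
  then show ?case
    using vector_derivative_unique_at[OF test_function_derivative[OF f]] by blast
qed

text \<open>Derivatives of a test function vanish outside its compact support, so any continuous weight is harmless. The weights
\<open>1\<close> and \<open>1 + x\<^sup>2\<close> give the bounds on the first two derivatives that control traces.\<close>

lemma test_function_weighted_bound: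
  assumes f: "f \<in> test_functions" and w: "continuous_on UNIV w"
  obtains B :: real where "\<And>x. cmod (nth_deriv k f x) * w x \<le> B"
proof -
  let ?g = "\<lambda>x. cmod (nth_deriv k f x) * w x" and ?K = "closure {x. f x \<noteq> 0}"
  have "continuous_on UNIV (nth_deriv k f)"
    using f unfolding test_functions_def
    by (auto intro!: differentiable_imp_continuous_on simp: differentiable_on_def)
  then have "continuous_on UNIV ?g"
    by (intro continuous_on_mult continuous_on_norm w)
  then have "continuous_on ?K ?g"
    by (rule continuous_on_subset) simp
  moreover have "compact ?K" using f by (simp add: test_functions_def)
  ultimately have "bounded (?g ` ?K)"
    by (intro compact_imp_bounded compact_continuous_image)
  then obtain B where B: "\<And>x. x \<in> ?K \<Longrightarrow> \<bar>?g x\<bar> \<le> B"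
    unfolding bounded_real by blast
  have "?g x \<le> max B 0" for x
  proof (cases "x \<in> ?K")
    case True
    then show ?thesis using B[OF True] by linarith
  qed (simp add: test_function_support[OF f])
  then show ?thesis by (rule that)
qed

text \<open>The constant is chosen before the matrices, and therefore does not depend on their size. Real and imaginary
parts are treated separately because convexity concerns real functions.\<close>

lemma trace_test_function_diff_le:
  fixes f :: "real \<Rightarrow> complex"
  assumes f: "f \<in> test_functions"
  obtains C where "C \<ge> 0"
    "\<And>S K K' (D :: 'i \<Rightarrow> real) N N' e e' a b. diagonal_perturbation S K K' D N N' e e' a b \<Longrightarrow>
      cmod ((\<Sum>i<N. f (a i)) - (\<Sum>j<N'. f (b j))) \<le> C * (\<Sum>n\<in>S. \<bar>D n\<bar>)"
proof -
  obtain C where C: "\<And>x. cmod (nth_deriv 1 f x) * 1 \<le> C"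
    using test_function_weighted_bound[OF f continuous_on_const] by blast
  obtain c where c: "\<And>x. cmod (nth_deriv 2 f x) * (1 + x\<^sup>2) \<le> c"
    by (rule test_function_weighted_bound[OF f, of "\<lambda>x. 1 + x\<^sup>2" 2]) (auto intro!: continuous_intros)
  have d: "(f has_vector_derivative nth_deriv 1 f x) (at x)"
      "(nth_deriv 1 f has_vector_derivative nth_deriv 2 f x) (at x)" for x
    using test_function_derivative[OF f, of 0 x] test_function_derivative[OF f, of 1 x]
    by (simp_all add: nth_deriv_def numeral_2_eq_2)
  have Re: "\<bar>Re ((\<Sum>i<N. f (a i)) - (\<Sum>j<N'. f (b j)))\<bar> \<le> (C + 4 * c) * (\<Sum>n\<in>S. \<bar>D n\<bar>)"
    and Im: "\<bar>Im ((\<Sum>i<N. f (a i)) - (\<Sum>j<N'. f (b j)))\<bar> \<le> (C + 4 * c) * (\<Sum>n\<in>S. \<bar>D n\<bar>)"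
    if "diagonal_perturbation S K K' D N N' e e' a b"
    for S K K' and D :: "'i \<Rightarrow> real" and N N' e e' a b
  proof -
    interpret diagonal_perturbation S K K' D N N' e e' a b by fact
    have bounds: "\<bar>Re (nth_deriv 1 f x)\<bar> \<le> C" "\<bar>Im (nth_deriv 1 f x)\<bar> \<le> C"
        "\<bar>Re (nth_deriv 2 f x)\<bar> * (1 + x\<^sup>2) \<le> c" "\<bar>Im (nth_deriv 2 f x)\<bar> * (1 + x\<^sup>2) \<le> c" for x
      using C[of x] abs_Re_le_cmod[of "nth_deriv 1 f x"] abs_Im_le_cmod[of "nth_deriv 1 f x"]
        order_trans[OF mult_right_mono[OF abs_Re_le_cmod] c[of x]]
        order_trans[OF mult_right_mono[OF abs_Im_le_cmod] c[of x]]
      by simp_all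
    have "\<bar>(\<Sum>i<N. Re (f (a i))) - (\<Sum>j<N'. Re (f (b j)))\<bar> \<le> (C + 4 * c) * (\<Sum>n\<in>S. \<bar>D n\<bar>)"
      by (rule trace_C2_diff_le[where \<phi> = "\<lambda>x. Re (f x)" and \<phi>' = "\<lambda>x. Re (nth_deriv 1 f x)"
            and \<phi>'' = "\<lambda>x. Re (nth_deriv 2 f x)"])
        (use bounds d in \<open>auto simp: has_real_derivative_iff_has_vector_derivative
          intro: bounded_linear.has_vector_derivative[OF bounded_linear_Re]\<close>)
    then show "\<bar>Re ((\<Sum>i<N. f (a i)) - (\<Sum>j<N'. f (b j)))\<bar> \<le> (C + 4 * c) * (\<Sum>n\<in>S. \<bar>D n\<bar>)" by simp
    have "\<bar>(\<Sum>i<N. Im (f (a i))) - (\<Sum>j<N'. Im (f (b j)))\<bar> \<le> (C + 4 * c) * (\<Sum>n\<in>S. \<bar>D n\<bar>)"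
      by (rule trace_C2_diff_le[where \<phi> = "\<lambda>x. Im (f x)" and \<phi>' = "\<lambda>x. Im (nth_deriv 1 f x)"
            and \<phi>'' = "\<lambda>x. Im (nth_deriv 2 f x)"])
        (use bounds d in \<open>auto simp: has_real_derivative_iff_has_vector_derivative
          intro: bounded_linear.has_vector_derivative[OF bounded_linear_Im]\<close>)
    then show "\<bar>Im ((\<Sum>i<N. f (a i)) - (\<Sum>j<N'. f (b j)))\<bar> \<le> (C + 4 * c) * (\<Sum>n\<in>S. \<bar>D n\<bar>)" by simp
  qed
  show ?thesis
  proof (rule that[of "2 * (C + 4 * c)"])
    have "0 \<le> C" "0 \<le> c" using order_trans[OF _ C[of 0]] order_trans[OF _ c[of 0]] by simp_all
    then show "0 \<le> 2 * (C + 4 * c)" by simp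
    fix S K K' and D :: "'i \<Rightarrow> real" and N N' e e' a b
    assume pert: "diagonal_perturbation S K K' D N N' e e' a b"
    show "cmod ((\<Sum>i<N. f (a i)) - (\<Sum>j<N'. f (b j))) \<le> 2 * (C + 4 * c) * (\<Sum>n\<in>S. \<bar>D n\<bar>)"
      using Re[OF pert] Im[OF pert] cmod_le[of "(\<Sum>i<N. f (a i)) - (\<Sum>j<N'. f (b j))"] by linarith
  qed
qed

lemma integral_spectral_counting_measure_diff_le:
  fixes f :: "real \<Rightarrow> complex" and E :: real
  assumes f: "f \<in> test_functions"
  obtains C where "C \<ge> 0"
    "\<And>L (V :: ('d::finite) site \<Rightarrow> real). L > 0 \<Longrightarrow>
      cmod ((\<integral>x. f x \<partial>spectral_counting_measure L E (hamiltonian V))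
        - (\<integral>x. f x \<partial>spectral_counting_measure L E (lattice_laplacian :: 'd wave \<Rightarrow> 'd wave)))
      \<le> C * ((L + 1) / (2 * L + 1) ^ (CARD('d) - 1) * (\<Sum>n\<in>box L. \<bar>V n\<bar>))"
proof -
  obtain C where "C \<ge> 0" and C:
    "\<And>S K K' (D :: 'd site \<Rightarrow> real) N N' e e' a b. diagonal_perturbation S K K' D N N' e e' a b \<Longrightarrow>
      cmod ((\<Sum>i<N. f (a i)) - (\<Sum>j<N'. f (b j))) \<le> C * (\<Sum>n\<in>S. \<bar>D n\<bar>)"
    by (rule trace_test_function_diff_le[OF f]) (rule that)
  have "continuous_on UNIV f"
    using has_vector_derivative_continuous[OF test_function_derivative[OF f, of 0]]
    by (intro continuous_at_imp_continuous_on) (simp add: nth_deriv_def)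
  then have meas: "f \<in> borel_measurable borel" by (rule borel_measurable_continuous_onI)
  show ?thesis
  proof (rule that[OF \<open>C \<ge> 0\<close>])
    fix L :: real and V :: "'d site \<Rightarrow> real"
    assume L: "L > 0"
    let ?K = "hamiltonian_kernel L E V" and ?K' = "hamiltonian_kernel L E (\<lambda>_ :: 'd site. 0)"
    let ?c = "1 / (2 * L + 1) ^ (CARD('d) - 1)"
    have free: "(lattice_laplacian :: 'd wave \<Rightarrow> 'd wave) = hamiltonian (\<lambda>_. 0)"
      by (intro ext) (simp add: hamiltonian_def)
    obtain N e a where e: "eigenbasis (box L) ?K N e a"
      by (rule eigenbasis_exists[OF finite_box hermitian_hamiltonian_kernel])
    obtain N' e' b where e': "eigenbasis (box L) ?K' N' e' b"
      by (rule eigenbasis_exists[OF finite_box hermitian_hamiltonian_kernel])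
    have "?K n m = ?K' n m + (if n = m then of_real ((L + 1) * V n) else 0)" for n m
    proof (cases "n = m")
      case True
      then have K_eq: "?K n m = of_real ((L + 1) * (V n - E))" "?K' n m = of_real ((L + 1) * (0 - E))"
        by (simp_all add: hamiltonian_kernel_def)
      show ?thesis unfolding K_eq using True by (simp add: algebra_simps)
    qed (simp add: hamiltonian_kernel_def)
    then have "diagonal_perturbation (box L) ?K ?K' (\<lambda>n. (L + 1) * V n) N N' e e' a b"
      using e e' finite_box hermitian_hamiltonian_kernel
      by unfold_locales
    from C[OF this] have trace: "cmod ((\<Sum>i<N. f (a i)) - (\<Sum>j<N'. f (b j))) \<le> C * ((L + 1) * (\<Sum>n\<in>box L. \<bar>V n\<bar>))"
      using L by (simp add: abs_mult sum_distrib_left)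
    have "(\<integral>x. f x \<partial>spectral_counting_measure L E (hamiltonian V))
        - (\<integral>x. f x \<partial>spectral_counting_measure L E (lattice_laplacian :: 'd wave \<Rightarrow> 'd wave))
      = of_real ?c * ((\<Sum>i<N. f (a i)) - (\<Sum>j<N'. f (b j)))"
      unfolding free
      integral_spectral_counting_measure[OF L scaled_compression_hamiltonian hermitian_hamiltonian_kernel e meas]
      integral_spectral_counting_measure[OF L scaled_compression_hamiltonian hermitian_hamiltonian_kernel e' meas]
      by (rule right_diff_distrib[symmetric])
    then have "cmod ((\<integral>x. f x \<partial>spectral_counting_measure L E (hamiltonian V))
        - (\<integral>x. f x \<partial>spectral_counting_measure L E (lattice_laplacian :: 'd wave \<Rightarrow> 'd wave)))
      = ?c * cmod ((\<Sum>i<N. f (a i)) - (\<Sum>j<N'. f (b j)))"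
      using L by (simp add: norm_mult norm_divide norm_power flip: of_real_power of_real_mult of_real_add)
    also have "\<dots> \<le> ?c * (C * ((L + 1) * (\<Sum>n\<in>box L. \<bar>V n\<bar>)))"
      using L by (intro mult_left_mono trace) auto
    finally show "cmod ((\<integral>x. f x \<partial>spectral_counting_measure L E (hamiltonian V))
        - (\<integral>x. f x \<partial>spectral_counting_measure L E (lattice_laplacian :: 'd wave \<Rightarrow> 'd wave)))
      \<le> C * ((L + 1) / (2 * L + 1) ^ (CARD('d) - 1) * (\<Sum>n\<in>box L. \<bar>V n\<bar>))"
      by simp
  qed
qed


section \<open>Sums of identically distributed variables over growing boxes\<close>

text \<open>This bound and the next one hold pointwise. Integrated against the common distribution of the random
variables, they bound the Borel-Cantelli series of the truncation argument by a multiple of the first absolute moment.\<close>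

lemma sum_geometric_below_le:
  fixes D x :: real
  assumes "D \<ge> 2" "x \<ge> 0"
  shows "(\<Sum>k<K. if D ^ k < x then D ^ k else 0) \<le> 2 * x"
proof (induction K)
  case (Suc K)
  have geo: "(\<Sum>k<Suc n. D ^ k) \<le> 2 * D ^ n" for n
  proof (induction n)
    case (Suc n)
    have "2 * D ^ n \<le> D * D ^ n" using assms by (intro mult_right_mono) auto
    with Suc show ?case by simp
  qed simp
  show ?case
  proof (cases "D ^ K < x")
    case True
    have "(\<Sum>k<Suc K. if D ^ k < x then D ^ k else 0) \<le> (\<Sum>k<Suc K. D ^ k)"
      using assms by (intro sum_mono) auto
    with geo[of K] True show ?thesis by simp
  qed (use Suc in simp)
qed (use assms in simp)

lemma sum_geometric_above_le:
  fixes D x :: real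
  assumes "D \<ge> 2" "x \<ge> 0"
  shows "(\<Sum>k<K. if x \<le> D ^ k then x\<^sup>2 / D ^ k else 0) \<le> 2 * x"
proof -
  have pos: "D ^ k > 0" for k using assms by simp
  \<comment> \<open>the additional term bounds the tail of the geometric series that starts at the index \<open>K\<close>\<close>
  have "(\<Sum>k<K. if x \<le> D ^ k then x\<^sup>2 / D ^ k else 0) + 2 * x\<^sup>2 / max x (D ^ K) \<le> 2 * x"
  proof (induction K)
    case 0
    have "x\<^sup>2 \<le> x * max x 1" using assms unfolding power2_eq_square by (intro mult_left_mono) auto
    then show ?case by (simp add: divide_le_eq max_def mult_ac split: if_splits)
  next
    case (Suc K)
    have DK: "2 * D ^ K \<le> D ^ Suc K" using assms by simp
    have mx: "max x (D ^ K) \<le> max x (D ^ Suc K)" 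
      by (rule max.mono) (use DK pos[of K] in linarith)+
    have mp: "max x (D ^ K) > 0" using pos[of K] by (auto simp: max_def)
    show ?case
    proof (cases "x \<le> D ^ K")
      case True
      have "2 * x\<^sup>2 / max x (D ^ Suc K) \<le> 2 * x\<^sup>2 / (2 * D ^ K)"
        by (rule frac_le) (use DK pos[of K] in \<open>auto simp: le_max_iff_disj simp del: power_Suc\<close>)
      moreover have "max x (D ^ K) = D ^ K" using True by simp
      moreover have "x \<le> D ^ Suc K" using True DK pos[of K] by linarith
      ultimately show ?thesis using Suc True by (simp add: field_simps)
    next
      case False
      have "2 * x\<^sup>2 / max x (D ^ Suc K) \<le> 2 * x\<^sup>2 / max x (D ^ K)"
        by (rule frac_le) (use mx mp in auto)
      then show ?thesis using Suc False by simp
    qed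
  qed
  moreover have "2 * x\<^sup>2 / max x (D ^ K) \<ge> 0" using pos[of K] assms by (simp add: max_def)
  ultimately show ?thesis by linarith
qed

lemma (in prob_space) second_moment_centered_sum:
  fixes Z :: "'i \<Rightarrow> 'a \<Rightarrow> real"
  assumes indep: "indep_vars (\<lambda>_. borel) Z UNIV" and I: "finite I"
    and bdd: "\<And>n \<omega>. \<bar>Z n \<omega>\<bar> \<le> b" and centered: "\<And>n. expectation (Z n) = 0"
  shows "expectation (\<lambda>\<omega>. (\<Sum>n\<in>I. Z n \<omega>)\<^sup>2) = (\<Sum>n\<in>I. expectation (\<lambda>\<omega>. (Z n \<omega>)\<^sup>2))"
proof -
  have [measurable]: "Z n \<in> borel_measurable M" for n
    using indep by (auto simp: indep_vars_def)
  have int: "integrable M (Z n)" for n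
    by (rule integrable_const_bound[where B = b]) (use bdd in auto)
  have int2: "integrable M (\<lambda>\<omega>. Z n \<omega> * Z m \<omega>)" for n m
    by (rule integrable_const_bound[where B = "b * b"])
      (use bdd in \<open>auto simp: abs_mult intro!: mult_mono order_trans[OF abs_ge_zero bdd]\<close>)
  have cross: "expectation (\<lambda>\<omega>. Z n \<omega> * Z m \<omega>) = 0" if "n \<noteq> m" for n m
  proof -
    have "indep_vars (\<lambda>_. borel) Z {n, m}" by (rule indep_vars_subset[OF indep]) simp
    from indep_vars_lebesgue_integral[OF _ this int] that show ?thesis
      by (simp add: centered)
  qed
  have "expectation (\<lambda>\<omega>. (\<Sum>n\<in>I. Z n \<omega>)\<^sup>2) = (\<Sum>n\<in>I. \<Sum>m\<in>I. expectation (\<lambda>\<omega>. Z n \<omega> * Z m \<omega>))"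
    by (simp add: power2_eq_square sum_product int2)
  also have "\<dots> = (\<Sum>n\<in>I. \<Sum>m\<in>I. if m = n then expectation (\<lambda>\<omega>. (Z n \<omega>)\<^sup>2) else 0)"
    by (intro sum.cong refl) (auto simp: cross power2_eq_square)
  also have "\<dots> = (\<Sum>n\<in>I. expectation (\<lambda>\<omega>. (Z n \<omega>)\<^sup>2))"
    using I by simp
  finally show ?thesis .
qed

text \<open>Etemadi's argument. In block \<open>k\<close> the variables are truncated at the level \<open>D ^ k\<close>, comparable to the size of
the block. The event \<open>A k\<close> that some truncation is visible and the event \<open>B k\<close> that the truncated sum deviates from
its mean by at least \<open>D ^ k\<close> (estimated by second moments) both have summable probabilities. From some block on, the sum is
therefore at most \<open>D ^ k\<close> plus its mean.\<close>

lemma (in prob_space) AE_geometric_block_sums_bounded: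
  fixes X :: "'i \<Rightarrow> 'a \<Rightarrow> real" and D c :: real
  assumes indep: "indep_vars (\<lambda>_. borel) X UNIV"
    and dist: "\<And>n. distr M borel (X n) = N"
    and int: "integrable N (\<lambda>x. \<bar>x\<bar>)"
    and D: "D \<ge> 2" and fin: "\<And>k. finite (S k)" and card: "\<And>k. real (card (S k)) \<le> c * D ^ k"
  shows "AE \<omega> in M. \<exists>Q. \<forall>k. (\<Sum>n\<in>S k. \<bar>X n \<omega>\<bar>) \<le> Q * D ^ k"
proof -
  have X[measurable]: "X n \<in> borel_measurable M" for n
    using indep by (auto simp: indep_vars_def)
  have [measurable_cong]: "sets N = sets borel" using dist by (metis sets_distr)
  interpret N: prob_space N
    using prob_space_distr[OF X] dist by metis
  have E_X: "expectation (\<lambda>\<omega>. f (X n \<omega>)) = (\<integral>x. f x \<partial>N)"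
    if [measurable]: "f \<in> borel_measurable borel" for f :: "real \<Rightarrow> real" and n
    unfolding dist[of n, symmetric] by (rule integral_distr[symmetric]) auto
  have Dpos: "D ^ k > 0" and Dge1: "D ^ k \<ge> 1" for k using D by auto
  have "c \<ge> 0" using card[of 0] by simp
  define m where "m = (\<integral>x. \<bar>x\<bar> \<partial>N)"
  have "m \<ge> 0" by (simp add: m_def)

  define t where "t k x = (if \<bar>x\<bar> \<le> D ^ k then \<bar>x\<bar> else 0)" for k x
  have [measurable]: "t k \<in> borel_measurable borel" for k unfolding t_def by measurable
  have t: "0 \<le> t k x" "t k x \<le> \<bar>x\<bar>" "\<bar>t k x\<bar> \<le> D ^ k" for k x
    using Dpos[of k] by (auto simp: t_def)
  have int_t: "integrable N (t k)" for k
    by (rule Bochner_Integration.integrable_bound[OF int]) (use t in auto)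
  have int_t2: "integrable N (\<lambda>x. (t k x)\<^sup>2)" for k
    by (rule N.integrable_const_bound[where B = "(D ^ k)\<^sup>2"])
      (use t in \<open>auto intro!: power_mono\<close>)
  define mt where "mt k = (\<integral>x. t k x \<partial>N)" for k
  have mt: "0 \<le> mt k" "mt k \<le> m" "mt k \<le> D ^ k" for k
  proof -
    show "mt k \<ge> 0" by (simp add: mt_def t)
    show "mt k \<le> m" unfolding mt_def m_def using int_t int t by (intro integral_mono) auto
    have "mt k \<le> (\<integral>x. D ^ k \<partial>N)" unfolding mt_def
      using int_t t(3) by (intro integral_mono) (auto dest: abs_le_D1)
    then show "mt k \<le> D ^ k" using N.prob_space by simp
  qed

  define A where "A k = (\<Union>n\<in>S k. {\<omega> \<in> space M. D ^ k < \<bar>X n \<omega>\<bar>})" for k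
  define B where "B k = {\<omega> \<in> space M. \<bar>\<Sum>n\<in>S k. (t k (X n \<omega>) - mt k)\<bar> \<ge> D ^ k}" for k
  have [measurable]: "A k \<in> sets M" for k
    unfolding A_def using fin by (intro sets.finite_UN) measurable
  have [measurable]: "B k \<in> sets M" for k
    unfolding B_def by measurable

  define p where "p k = D ^ k * measure N {x. D ^ k < \<bar>x\<bar>}" for k
  have p0: "p k \<ge> 0" for k using Dpos[of k] by (simp add: p_def)
  have "prob (A k) \<le> c * p k" for k
  proof -
    have "prob (A k) \<le> (\<Sum>n\<in>S k. prob {\<omega> \<in> space M. D ^ k < \<bar>X n \<omega>\<bar>})"
      unfolding A_def using fin by (intro finite_measure_subadditive_finite) auto
    also have "\<dots> = (\<Sum>n\<in>S k. measure N {x. D ^ k < \<bar>x\<bar>})"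
    proof (rule sum.cong[OF refl])
      fix n
      have "measure N {x. D ^ k < \<bar>x\<bar>} = prob (X n -` {x. D ^ k < \<bar>x\<bar>} \<inter> space M)"
        unfolding dist[of n, symmetric] by (rule measure_distr) auto
      also have "X n -` {x. D ^ k < \<bar>x\<bar>} \<inter> space M = {\<omega> \<in> space M. D ^ k < \<bar>X n \<omega>\<bar>}" by auto
      finally show "prob {\<omega> \<in> space M. D ^ k < \<bar>X n \<omega>\<bar>} = measure N {x. D ^ k < \<bar>x\<bar>}" ..
    qed
    also have "\<dots> \<le> c * D ^ k * measure N {x. D ^ k < \<bar>x\<bar>}"
      using mult_right_mono[OF card[of k] measure_nonneg] by simp
    finally show ?thesis by (simp add: p_def mult_ac)
  qed
  then have le: "norm (prob (A k)) \<le> c * p k" for k by simp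
  have "summable p"
  proof (rule summableI_nonneg_bounded)
    fix K
    have eq: "(if D ^ k < \<bar>x\<bar> then D ^ k else 0) = D ^ k * indicator {x. D ^ k < \<bar>x\<bar>} x" for k x
      by (auto simp: indicator_def)
    have i: "integrable N (\<lambda>x. (\<Sum>k<K. if D ^ k < \<bar>x\<bar> then D ^ k else 0))"
      unfolding eq by (intro Bochner_Integration.integrable_sum integrable_mult_right integrable_real_indicator)
        (auto simp: N.emeasure_eq_measure)
    have "sum p {..<K} = (\<integral>x. (\<Sum>k<K. if D ^ k < \<bar>x\<bar> then D ^ k else 0) \<partial>N)"
      unfolding eq by (subst Bochner_Integration.integral_sum)
        (auto simp: p_def N.emeasure_eq_measure intro!: integrable_mult_right integrable_real_indicator sum.cong)
    also have "\<dots> \<le> (\<integral>x. 2 * \<bar>x\<bar> \<partial>N)"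
      using i int D by (intro integral_mono sum_geometric_below_le) auto
    finally show "sum p {..<K} \<le> 2 * m" by (simp add: m_def)
  qed (rule p0)
  then have "summable (\<lambda>k. prob (A k))"
    using le by (rule summable_comparison_test'[OF summable_mult])
  then have AE_A: "AE \<omega> in M. eventually (\<lambda>k. \<omega> \<in> space M - A k) sequentially"
    by (rule borel_cantelli_AE1[rotated 2]) (simp_all add: less_top[symmetric])

  define r where "r k = (\<integral>x. (t k x)\<^sup>2 \<partial>N) / D ^ k" for k
  have r0: "r k \<ge> 0" for k using Dpos[of k] by (simp add: r_def)
  have "prob (B k) \<le> c * r k" for k
  proof -
    define Z where "Z n \<omega> = t k (X n \<omega>) - mt k" for n \<omega>
    have [measurable]: "Z n \<in> borel_measurable M" for n unfolding Z_def by measurable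
    have bdd: "\<bar>Z n \<omega>\<bar> \<le> D ^ k" for n \<omega>
      using t[of k "X n \<omega>"] mt[of k] unfolding Z_def by auto
    have ind: "indep_vars (\<lambda>_. borel) Z UNIV" unfolding Z_def
      by (rule indep_vars_compose2[OF indep, where Y = "\<lambda>_ x. t k x - mt k"]) measurable
    have cen: "expectation (Z n) = 0" for n
      unfolding Z_def using E_X[of "\<lambda>x. t k x - mt k" n] int_t[of k]
      by (simp add: mt_def N.prob_space)
    have sq: "expectation (\<lambda>\<omega>. (Z n \<omega>)\<^sup>2) \<le> (\<integral>x. (t k x)\<^sup>2 \<partial>N)" for n
      unfolding Z_def using E_X[of "\<lambda>x. (t k x - mt k)\<^sup>2" n] N.variance_eq[OF int_t int_t2, of k]
      by (simp add: mt_def)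
    have "integrable M (\<lambda>\<omega>. (\<Sum>n\<in>S k. Z n \<omega>)\<^sup>2)"
    proof (rule integrable_const_bound[where B = "(real (card (S k)) * D ^ k)\<^sup>2"])
      have "\<bar>\<Sum>n\<in>S k. Z n \<omega>\<bar> \<le> real (card (S k)) * D ^ k" for \<omega>
        using order_trans[OF sum_abs sum_bounded_above[of "S k" "\<lambda>n. \<bar>Z n \<omega>\<bar>" "D ^ k"]] bdd by simp
      from power_mono[OF this abs_ge_zero, of _ 2]
      show "AE \<omega> in M. norm ((\<Sum>n\<in>S k. Z n \<omega>)\<^sup>2) \<le> (real (card (S k)) * D ^ k)\<^sup>2"
        by simp
    qed measurable
    then have "prob (B k) \<le> expectation (\<lambda>\<omega>. (\<Sum>n\<in>S k. Z n \<omega>)\<^sup>2) / (D ^ k)\<^sup>2"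
      unfolding B_def Z_def[symmetric] using Dpos[of k] by (intro second_moment_method) auto
    also have "expectation (\<lambda>\<omega>. (\<Sum>n\<in>S k. Z n \<omega>)\<^sup>2) = (\<Sum>n\<in>S k. expectation (\<lambda>\<omega>. (Z n \<omega>)\<^sup>2))"
      by (rule second_moment_centered_sum[OF ind fin bdd cen])
    also have "\<dots> \<le> real (card (S k)) * (\<integral>x. (t k x)\<^sup>2 \<partial>N)"
      using sq by (rule sum_bounded_above)
    also have "\<dots> \<le> c * D ^ k * (\<integral>x. (t k x)\<^sup>2 \<partial>N)"
      using card by (intro mult_right_mono) auto
    finally have "prob (B k) \<le> c * D ^ k * (\<integral>x. (t k x)\<^sup>2 \<partial>N) / (D ^ k)\<^sup>2"
      by (simp add: divide_right_mono)
    also have "\<dots> = c * r k"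
      using Dpos[of k] unfolding r_def by (simp add: power2_eq_square[of "D ^ k"])
    finally show ?thesis .
  qed
  then have le: "norm (prob (B k)) \<le> c * r k" for k by simp
  have "summable r"
  proof (rule summableI_nonneg_bounded)
    fix K
    have eq: "(if \<bar>x\<bar> \<le> D ^ k then \<bar>x\<bar>\<^sup>2 / D ^ k else 0) = (t k x)\<^sup>2 / D ^ k" for k x
      by (auto simp: t_def)
    have "sum r {..<K} = (\<integral>x. (\<Sum>k<K. (t k x)\<^sup>2 / D ^ k) \<partial>N)"
      by (simp add: r_def int_t2)
    also have "\<dots> \<le> (\<integral>x. 2 * \<bar>x\<bar> \<partial>N)"
      using int int_t2 D sum_geometric_above_le[of D "\<bar>_\<bar>" K] unfolding eq
      by (intro integral_mono) auto
    finally show "sum r {..<K} \<le> 2 * m" by (simp add: m_def)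
  qed (rule r0)
  then have "summable (\<lambda>k. prob (B k))"
    using le by (rule summable_comparison_test'[OF summable_mult])
  then have AE_B: "AE \<omega> in M. eventually (\<lambda>k. \<omega> \<in> space M - B k) sequentially"
    by (rule borel_cantelli_AE1[rotated 2]) (simp_all add: less_top[symmetric])

  show ?thesis
    using AE_A AE_B
  proof eventually_elim
    case (elim \<omega>)
    then obtain k0 where k0: "\<And>k. k \<ge> k0 \<Longrightarrow> \<omega> \<in> space M - A k \<and> \<omega> \<in> space M - B k"
      using eventually_conj[OF elim] unfolding eventually_sequentially by auto
    define s where "s k = (\<Sum>n\<in>S k. \<bar>X n \<omega>\<bar>)" for k
    have s0: "s k \<ge> 0" for k by (auto simp: s_def intro: sum_nonneg)
    have large: "s k \<le> (1 + c * m) * D ^ k" if "k \<ge> k0" for k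
    proof -
      have "s k = (\<Sum>n\<in>S k. t k (X n \<omega>))"
        using k0[OF that] by (auto simp: s_def t_def A_def not_less intro!: sum.cong)
      also have "\<dots> = (\<Sum>n\<in>S k. (t k (X n \<omega>) - mt k)) + real (card (S k)) * mt k"
        by (simp add: sum_subtractf)
      also have "\<dots> \<le> D ^ k + c * D ^ k * m"
        using k0[OF that] mt[of k] card[of k] \<open>c \<ge> 0\<close> Dpos[of k]
        by (intro add_mono mult_mono) (auto simp: B_def)
      finally show ?thesis by (simp add: algebra_simps)
    qed
    \<comment> \<open>the finitely many blocks before \<open>k0\<close> are absorbed into the constant\<close>
    have "s k \<le> (1 + c * m + (\<Sum>j<k0. s j)) * D ^ k" for k
    proof (cases "k \<ge> k0")
      case True
      have "0 \<le> (\<Sum>j<k0. s j) * D ^ k" using s0 Dpos[of k] by (simp add: sum_nonneg)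
      with large[OF True] show ?thesis by (simp add: algebra_simps)
    next
      case False
      have "s k \<le> (\<Sum>j<k0. s j)" using False s0 by (intro member_le_sum) auto
      also have "\<dots> \<le> 1 + c * m + (\<Sum>j<k0. s j)" using \<open>c \<ge> 0\<close> \<open>m \<ge> 0\<close> by simp
      also have "\<dots> \<le> (1 + c * m + (\<Sum>j<k0. s j)) * D ^ k"
        using mult_left_mono[OF Dge1[of k], of "1 + c * m + (\<Sum>j<k0. s j)"] \<open>c \<ge> 0\<close> \<open>m \<ge> 0\<close> s0
        by (simp add: sum_nonneg)
      finally show ?thesis .
    qed
    then show ?case unfolding s_def by blast
  qed
qed

text \<open>The smallest dyadic box that contains the box of radius \<open>L\<close> has radius at most \<open>2 * L + 1\<close>; the summand \<open>1\<close>
covers small \<open>L\<close>, where the dyadic radius is \<open>1\<close>.\<close>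

lemma sum_box_le_from_dyadic:
  fixes g :: "('d::finite) site \<Rightarrow> real"
  assumes g: "\<And>n. g n \<ge> 0" and L: "L > 0"
    and dyadic: "\<And>k. (\<Sum>n\<in>box (2 ^ k). g n) \<le> Q * (2 ^ CARD('d)) ^ k"
  shows "(\<Sum>n\<in>box L. g n) \<le> Q * (2 * L + 1) ^ CARD('d)"
proof -
  have "Q \<ge> 0" using dyadic[of 0] order_trans[OF sum_nonneg[OF g]] by simp
  define k where "k = (LEAST k. L \<le> 2 ^ k)"
  have "\<exists>k. L < 2 ^ k" by (rule real_arch_pow) simp
  then have "\<exists>k. L \<le> 2 ^ k" using less_imp_le by blast
  then have k: "L \<le> 2 ^ k" unfolding k_def by (rule LeastI_ex)
  have k': "2 ^ k \<le> 2 * L + 1"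
  proof (cases k)
    case (Suc j)
    then have "\<not> L \<le> 2 ^ j" using not_less_Least[of j "\<lambda>k. L \<le> 2 ^ k"] by (simp add: k_def)
    then show ?thesis using Suc by simp
  qed (use L in simp)
  have "(box L :: 'd site set) \<subseteq> box (2 ^ k)" using k by (auto simp: box_def intro: order_trans)
  then have "(\<Sum>n\<in>box L. g n) \<le> (\<Sum>n\<in>box (2 ^ k). g n)"
    using g by (intro sum_mono2 finite_box) auto
  also have "\<dots> \<le> Q * (2 ^ k) ^ CARD('d)"
    using dyadic[of k] by (simp add: mult.commute flip: power_mult)
  also have "\<dots> \<le> Q * (2 * L + 1) ^ CARD('d)"
    using k' \<open>Q \<ge> 0\<close> by (intro mult_left_mono power_mono) auto
  finally show ?thesis .
qed

lemma (in prob_space) AE_box_sums_bounded: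
  fixes q :: "('d::finite) site \<Rightarrow> 'a \<Rightarrow> real"
  assumes "indep_vars (\<lambda>_. borel) q UNIV" "\<And>n. distr M borel (q n) = \<nu>"
    "integrable \<nu> (\<lambda>x. \<bar>x\<bar>)"
  shows "AE \<omega> in M. \<exists>Q. \<forall>L>0. (\<Sum>n\<in>box L. \<bar>q n \<omega>\<bar>) \<le> Q * (2 * L + 1) ^ CARD('d)"
proof -
  have card: "real (card (box (2 ^ k) :: 'd site set)) \<le> 3 ^ CARD('d) * (2 ^ CARD('d)) ^ k" for k
  proof -
    have "real (card (box (2 ^ k) :: 'd site set)) = (2 * 2 ^ k + 1) ^ CARD('d)"
      using card_box_of_nat[of "2 ^ k", where 'd = 'd] by (simp add: add.commute)
    also have "\<dots> \<le> (3 * 2 ^ k) ^ CARD('d)" by (intro power_mono) auto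
    also have "\<dots> = 3 ^ CARD('d) * (2 ^ CARD('d)) ^ k"
      by (simp add: power_mult_distrib mult.commute flip: power_mult)
    finally show ?thesis .
  qed
  have "(2::real) \<le> 2 ^ CARD('d)"
    using power_increasing[of 1 "CARD('d)" "2::real"] by (simp add: Suc_le_eq)
  from AE_geometric_block_sums_bounded[OF assms this finite_box card]
  show ?thesis
  proof eventually_elim
    case (elim \<omega>)
    then obtain Q where "\<And>k. (\<Sum>n\<in>box (2 ^ k). \<bar>q n \<omega>\<bar>) \<le> Q * (2 ^ CARD('d)) ^ k" by blast
    then show ?case using sum_box_le_from_dyadic[of "\<lambda>n. \<bar>q n \<omega>\<bar>"] by auto
  qed
qed


section \<open>Limit points\<close>

lemma distributional_limit_points_subset:
  assumes "\<And>f. f \<in> test_functions \<Longrightarrow>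
    ((\<lambda>\<eta>. (\<integral>x. f x \<partial>\<mu> \<eta>) - (\<integral>x. f x \<partial>\<mu>' \<eta>)) \<longlongrightarrow> 0) (at_right 0)"
  shows "distributional_limit_points \<mu> \<subseteq> distributional_limit_points \<mu>'"
proof
  fix \<Psi> assume "\<Psi> \<in> distributional_limit_points \<mu>"
  then obtain \<eta> :: "nat \<Rightarrow> real" where \<Psi>: "is_distribution \<Psi>" and \<eta>: "\<And>k. \<eta> k > 0" "\<eta> \<longlonglongrightarrow> 0"
    and lim: "\<And>f. f \<in> test_functions \<Longrightarrow> (\<lambda>k. \<integral>x. f x \<partial>\<mu> (\<eta> k)) \<longlonglongrightarrow> \<Psi> f"
    unfolding distributional_limit_points_def by blast
  have at_right: "filterlim \<eta> (at_right 0) sequentially"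
    using \<eta> by (auto simp: filterlim_at less_imp_neq[THEN not_sym])
  have "(\<lambda>k. \<integral>x. f x \<partial>\<mu>' (\<eta> k)) \<longlonglongrightarrow> \<Psi> f" if f: "f \<in> test_functions" for f
    using tendsto_diff[OF lim[OF f] filterlim_compose[OF assms[OF f] at_right]] by simp
  with \<Psi> \<eta> show "\<Psi> \<in> distributional_limit_points \<mu>'"
    unfolding distributional_limit_points_def by blast
qed

theorem theorem2p3:
  fixes M :: "'a measure"
    and \<nu> :: "real measure"
    and q :: "int ^ ('d::finite) \<Rightarrow> 'a \<Rightarrow> real"
    and E :: real
    and \<epsilon> :: "real \<Rightarrow> real"
  assumes "- 2 * real CARD('d) < E" and "E < 2 * real CARD('d)"
    and "prob_space \<nu>" and "sets \<nu> = sets borel"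
    and "integrable \<nu> (\<lambda>x. \<bar>x\<bar>)"
    and "prob_space M"
    and "prob_space.indep_vars M (\<lambda>_. borel) q UNIV"
    and "\<And>n. distr M borel (q n) = \<nu>"
    and "\<And>\<eta>. \<eta> > 0 \<Longrightarrow> \<epsilon> \<eta> > 0"
    and "filterlim \<epsilon> at_top (at_right 0)"
    and "((\<lambda>\<eta>. (\<epsilon> \<eta>)\<^sup>2 * \<eta>) \<longlongrightarrow> 0) (at_right 0)"
  shows "AE \<omega> in M.
      distributional_limit_points
        (\<lambda>\<eta>. spectral_counting_measure (\<epsilon> \<eta>) E (hamiltonian (\<lambda>n. \<eta> * q n \<omega>))) =
      distributional_limit_points
        (\<lambda>\<eta>. spectral_counting_measure (\<epsilon> \<eta>) E (lattice_laplacian :: 'd wave \<Rightarrow> 'd wave))"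
  using prob_space.AE_box_sums_bounded[OF assms(6-8,5)]
proof eventually_elim
  case (elim \<omega>)
  let ?\<mu> = "\<lambda>\<eta>. spectral_counting_measure (\<epsilon> \<eta>) E (hamiltonian (\<lambda>n. \<eta> * q n \<omega>))"
  let ?free = "\<lambda>\<eta>. spectral_counting_measure (\<epsilon> \<eta>) E (lattice_laplacian :: 'd wave \<Rightarrow> 'd wave)"
  obtain Q where Q: "\<And>L. L > 0 \<Longrightarrow> (\<Sum>n\<in>box L. \<bar>q n \<omega>\<bar>) \<le> Q * (2 * L + 1) ^ CARD('d)"
    using elim by blast
  have "0 \<le> (\<Sum>n\<in>box 1. \<bar>q n \<omega>\<bar>)" by (simp add: sum_nonneg)
  also have "\<dots> \<le> Q * (2 * 1 + 1) ^ CARD('d)" by (rule Q) simp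
  finally have "Q \<ge> 0" using not_le zero_less_power[of "3 :: real" "CARD('d)"]
    by (fastforce simp: zero_le_mult_iff)
  \<comment> \<open>the estimate \<open>6 * C * Q * (L\<^sup>2 * \<eta>)\<close> below uses \<open>L + 1 \<le> 2 * L\<close> and \<open>2 * L + 1 \<le> 3 * L\<close>, valid once \<open>L \<ge> 1\<close>\<close>
  have diff: "((\<lambda>\<eta>. (\<integral>x. f x \<partial>?\<mu> \<eta>) - (\<integral>x. f x \<partial>?free \<eta>)) \<longlongrightarrow> 0) (at_right 0)"
    if f: "f \<in> test_functions" for f
  proof -
    obtain C where "C \<ge> 0" and C: "\<And>L (V :: 'd site \<Rightarrow> real). L > 0 \<Longrightarrow>
      cmod ((\<integral>x. f x \<partial>spectral_counting_measure L E (hamiltonian V))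
        - (\<integral>x. f x \<partial>spectral_counting_measure L E (lattice_laplacian :: 'd wave \<Rightarrow> 'd wave)))
      \<le> C * ((L + 1) / (2 * L + 1) ^ (CARD('d) - 1) * (\<Sum>n\<in>box L. \<bar>V n\<bar>))"
      by (rule integral_spectral_counting_measure_diff_le[OF f]) (rule that)
    have "cmod ((\<integral>x. f x \<partial>?\<mu> \<eta>) - (\<integral>x. f x \<partial>?free \<eta>)) \<le> 6 * C * Q * ((\<epsilon> \<eta>)\<^sup>2 * \<eta>)"
      if "\<eta> > 0" "\<epsilon> \<eta> \<ge> 1" for \<eta>
    proof -
      define L where "L = \<epsilon> \<eta>"
      have L: "L \<ge> 1" using that by (simp add: L_def)
      have "(\<Sum>n\<in>box L. \<bar>\<eta> * q n \<omega>\<bar>) = \<eta> * (\<Sum>n\<in>box L. \<bar>q n \<omega>\<bar>)"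
        using that by (simp add: abs_mult sum_distrib_left)
      also have "\<dots> \<le> \<eta> * (Q * (2 * L + 1) ^ CARD('d))"
        using Q[of L] L that by (intro mult_left_mono) auto
      finally have "C * ((L + 1) / (2 * L + 1) ^ (CARD('d) - 1) * (\<Sum>n\<in>box L. \<bar>\<eta> * q n \<omega>\<bar>))
          \<le> C * ((L + 1) / (2 * L + 1) ^ (CARD('d) - 1) * (\<eta> * (Q * (2 * L + 1) ^ CARD('d))))"
        using \<open>C \<ge> 0\<close> L by (intro mult_left_mono) auto
      also have "(2 * L + 1) ^ CARD('d) = (2 * L + 1) ^ (CARD('d) - 1) * (2 * L + 1)"
        by (subst power_minus_mult) auto
      also have "C * ((L + 1) / (2 * L + 1) ^ (CARD('d) - 1) *
            (\<eta> * (Q * ((2 * L + 1) ^ (CARD('d) - 1) * (2 * L + 1)))))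
          = C * Q * \<eta> * ((L + 1) * (2 * L + 1))"
        using L by simp
      also have "\<dots> \<le> C * Q * \<eta> * ((2 * L) * (3 * L))"
        using \<open>C \<ge> 0\<close> \<open>Q \<ge> 0\<close> L that by (intro mult_left_mono mult_mono) auto
      also have "\<dots> = 6 * C * Q * (L\<^sup>2 * \<eta>)" by (simp add: power2_eq_square)
      finally show ?thesis
        using order_trans[OF C[of L "\<lambda>n. \<eta> * q n \<omega>"]] L unfolding L_def by simp
    qed
    moreover have "eventually (\<lambda>\<eta>. \<eta> > 0 \<and> \<epsilon> \<eta> \<ge> 1) (at_right 0)"
      using assms(10) by (intro eventually_conj eventually_at_right_less)
        (auto simp: filterlim_at_top)
    ultimately have "eventually (\<lambda>\<eta>. norm ((\<integral>x. f x \<partial>?\<mu> \<eta>) - (\<integral>x. f x \<partial>?free \<eta>))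
        \<le> 6 * C * Q * ((\<epsilon> \<eta>)\<^sup>2 * \<eta>)) (at_right 0)"
      by (auto elim!: eventually_mono)
    then show ?thesis
      by (rule Lim_null_comparison) (use tendsto_mult_right_zero[OF assms(11)] in auto)
  qed
  moreover have "((\<lambda>\<eta>. (\<integral>x. f x \<partial>?free \<eta>) - (\<integral>x. f x \<partial>?\<mu> \<eta>)) \<longlongrightarrow> 0) (at_right 0)"
    if "f \<in> test_functions" for f
    using tendsto_minus[OF diff[OF that]] by simp
  ultimately show ?case
    by (intro subset_antisym distributional_limit_points_subset)
qed

end
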